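(* Let $\lambda\in[0,1)$ be fixed. Then the policy iteration algorithm for 2-player games solves in strongly polynomial time the instances of zero-sum two-player "discounted" stochastic games with perfect information and state dependent discount factors (possibly locally greater than $1$) that are such that, for every pair of policies $(\sigma,\delta)\in A_{\mathrm M}\times B_{\mathrm M}$ of the two players, the spectral radius of the associated (discounted) transition matrix $M^{(\sigma\delta)}$ is at most $\lambda$.
   Context: Instance: $n\ge1$; finite nonempty action sets $A_i$, $B_i$ for $i\in[n]=\{1,\dots,n\}$; for $i,j\in[n]$, $a\in A_i$, $b\in B_i$, transition probabilities $P^{ab}_{ij}\ge0$ with $\sum_jP^{ab}_{ij}=1$, discount factors $\gamma(i,a,b)\in[0,\infty)$ and payments $r^{ab}_i\in\mathbb{R}$. Put $M^{ab}_{ij}=\gamma(i,a,b)P^{ab}_{ij}$ and $$f_i(v)=\min_{a\in A_i}\max_{b\in B_i}\Bigl(\sum_jM^{ab}_{ij}v_j+r^{ab}_i\Bigr).$$ Solving the game means computing the solution $v\in\mathbb{R}^n$ of the dynamic programming equation $v=f(v)$ together with policies $\sigma,\delta$ attaining the minimum and maximum. Let $A\supseteq A_i$, $B\supseteq B_i$ for all $i$. $A_{\mathrm M}$ is the set of maps $\sigma:[n]\to A$ with $\sigma(i)\in A_i$; $B_{\mathrm M}$ is the set of maps $\delta:[n]\times A\to B$ with $\delta(i,a)\in B_i$. With $\sigma_i=\sigma(i)$ and $\delta_i=\delta(i,\sigma(i))$, put $M^{(\sigma\delta)}=(M^{\sigma_i\delta_i}_{ij})_{i,j}$, $f^{(\sigma\delta)}(v)=M^{(\sigma\delta)}v+(r^{\sigma_i\delta_i}_i)_i$,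 $f^{(\sigma)}(v)=\max_{\delta}f^{(\sigma\delta)}(v)$ (coordinatewise), so $f=\min_\sigma f^{(\sigma)}$. General policy iteration algorithm: (1) set $s=0$, choose $\sigma^0\in A_{\mathrm M}$ arbitrarily; (2) compute the fixed point $v^s$ of $f^{(\sigma^s)}$; (3) choose $\sigma^{s+1}$ with $f(v^s)=f^{(\sigma^{s+1})}(v^s)$, taking $\sigma^{s+1}=\sigma^s$ whenever possible; (4) if $\sigma^{s+1}=\sigma^s$ stop and return $v^s,\sigma^s$; otherwise increment $s$ and go to (2). The policy iteration algorithm for 2-player games runs this algorithm on $A_{\mathrm M},f,(f^{(\sigma)})$, computing $v^s$ in step (2) by running the same algorithm with $\max$ instead of $\min$ on $B_{\mathrm M},f^{(\sigma^s)},(f^{(\sigma^s\delta)})_{\delta}$, where fixed points of the affine maps $f^{(\sigma^s\delta)}$ are computed exactly by a (strongly polynomial) linear system solver. Strongly polynomial has the usual meaning: the number of arithmetic operations is bounded by a polynomial in the number of input data ($n$ and the number of triples $(i,a,b)$), independently of the numerical values, and on rational input the bit sizes of the numbers occurring are polynomially bounded in the input bit size. The constant $\lambda$ is not part of the input. *)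

theory Defs
  imports
    "Jordan_Normal_Form.Spectral_Radius"
    "HOL-Library.FuncSet"
    "HOL-Library.Log_Nat"
    "HOL-Library.Monad_Syntax"
begin

section \<open>Games\<close>

text \<open>States are \<open>0, ..., n - 1\<close>. The action sets are given as duplicate-free lists, since
  an algorithm has to enumerate them; the types \<open>'a\<close> and \<open>'b\<close> play the role of the ambient
  action sets.\<close>

record ('a, 'b) game =
  nstates :: nat
  acts1 :: "nat \<Rightarrow> 'a list"
  acts2 :: "nat \<Rightarrow> 'b list"
  prob :: "nat \<Rightarrow> 'a \<Rightarrow> 'b \<Rightarrow> nat \<Rightarrow> real"
  disc :: "nat \<Rightarrow> 'a \<Rightarrow> 'b \<Rightarrow> real"
  pay :: "nat \<Rightarrow> 'a \<Rightarrow> 'b \<Rightarrow> real"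

definition game_instance :: "('a, 'b) game \<Rightarrow> bool" where
  "game_instance G \<longleftrightarrow>
     1 \<le> nstates G \<and>
     (\<forall>i<nstates G. acts1 G i \<noteq> [] \<and> distinct (acts1 G i) \<and>
                    acts2 G i \<noteq> [] \<and> distinct (acts2 G i)) \<and>
     (\<forall>i<nstates G. \<forall>a\<in>set (acts1 G i). \<forall>b\<in>set (acts2 G i).
        0 \<le> disc G i a b \<and> (\<forall>j<nstates G. 0 \<le> prob G i a b j) \<and>
        (\<Sum>j<nstates G. prob G i a b j) = 1)"

definition payoff :: "('a, 'b) game \<Rightarrow> real vec \<Rightarrow> nat \<Rightarrow> 'a \<Rightarrow> 'b \<Rightarrow> real" where
  "payoff G v i a b = (\<Sum>j<nstates G. disc G i a b * prob G i a b j * v $ j) + pay G i a b"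

definition f_op :: "('a, 'b) game \<Rightarrow> real vec \<Rightarrow> real vec" where
  "f_op G v = vec (nstates G) (\<lambda>i.
     Min ((\<lambda>a. Max ((\<lambda>b. payoff G v i a b) ` set (acts2 G i))) ` set (acts1 G i)))"

definition policies1 :: "('a, 'b) game \<Rightarrow> (nat \<Rightarrow> 'a) set" where
  "policies1 G = (\<Pi>\<^sub>E i\<in>{..<nstates G}. set (acts1 G i))"

definition policies2 :: "('a, 'b) game \<Rightarrow> (nat \<times> 'a \<Rightarrow> 'b) set" where
  "policies2 G = (\<Pi>\<^sub>E (i, a)\<in>{..<nstates G} \<times> UNIV. set (acts2 G i))"

definition trans_mat :: "('a, 'b) game \<Rightarrow> (nat \<Rightarrow> 'a) \<Rightarrow> (nat \<times> 'a \<Rightarrow> 'b) \<Rightarrow> real mat" where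
  "trans_mat G \<sigma> \<delta> = mat (nstates G) (nstates G)
     (\<lambda>(i, j). disc G i (\<sigma> i) (\<delta> (i, \<sigma> i)) * prob G i (\<sigma> i) (\<delta> (i, \<sigma> i)) j)"

definition pay_vec :: "('a, 'b) game \<Rightarrow> (nat \<Rightarrow> 'a) \<Rightarrow> (nat \<times> 'a \<Rightarrow> 'b) \<Rightarrow> real vec" where
  "pay_vec G \<sigma> \<delta> = vec (nstates G) (\<lambda>i. pay G i (\<sigma> i) (\<delta> (i, \<sigma> i)))"

definition f_policies ::
    "('a, 'b) game \<Rightarrow> (nat \<Rightarrow> 'a) \<Rightarrow> (nat \<times> 'a \<Rightarrow> 'b) \<Rightarrow> real vec \<Rightarrow> real vec" where
  "f_policies G \<sigma> \<delta> v = trans_mat G \<sigma> \<delta> *\<^sub>v v + pay_vec G \<sigma> \<delta>"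

definition f_policy :: "('a, 'b) game \<Rightarrow> (nat \<Rightarrow> 'a) \<Rightarrow> real vec \<Rightarrow> real vec" where
  "f_policy G \<sigma> v = vec (nstates G) (\<lambda>i. Max ((\<lambda>\<delta>. f_policies G \<sigma> \<delta> v $ i) ` policies2 G))"

definition is_solution ::
    "('a, 'b) game \<Rightarrow> real vec \<Rightarrow> (nat \<Rightarrow> 'a) \<Rightarrow> (nat \<times> 'a \<Rightarrow> 'b) \<Rightarrow> bool" where
  "is_solution G v \<sigma> \<delta> \<longleftrightarrow>
     v \<in> carrier_vec (nstates G) \<and> f_op G v = v \<and>
     (\<forall>w\<in>carrier_vec (nstates G). f_op G w = w \<longrightarrow> w = v) \<and>
     \<sigma> \<in> policies1 G \<and> f_op G v = f_policy G \<sigma> v \<and>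
     \<delta> \<in> policies2 G \<and> (\<forall>\<tau>\<in>policies1 G. f_policy G \<tau> v = f_policies G \<tau> \<delta> v)"


section \<open>Size of the input\<close>

definition triples :: "('a, 'b) game \<Rightarrow> (nat \<times> 'a \<times> 'b) list" where
  "triples G = [(i, a, b). i \<leftarrow> [0..<nstates G], a \<leftarrow> acts1 G i, b \<leftarrow> acts2 G i]"

definition game_data :: "('a, 'b) game \<Rightarrow> real list" where
  "game_data G = concat (map (\<lambda>(i, a, b).
     disc G i a b # pay G i a b # map (prob G i a b) [0..<nstates G]) (triples G))"

text \<open>Sign, numerator and denominator in lowest terms; only meaningful for rational numbers.\<close>

definition bit_size :: "real \<Rightarrow> nat" where
  "bit_size x = (case quotient_of (THE r. x = real_of_rat r) of
     (p, q) \<Rightarrow> 1 + nat (bitlen \<bar>p\<bar>) + nat (bitlen q))"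

definition total_bits :: "real list \<Rightarrow> nat" where
  "total_bits xs = sum_list (map bit_size xs)"


section \<open>Computations with recorded arithmetic operations\<close>

text \<open>A computation carries its result together with the list of all arithmetic operations and
  comparisons performed, each recorded with its operands.\<close>

datatype arith = Add | Sub | Mul | Div

datatype event = Arith arith real real | Compare real real

fun apply_arith :: "arith \<Rightarrow> real \<Rightarrow> real \<Rightarrow> real" where
  "apply_arith Add x y = x + y"
| "apply_arith Sub x y = x - y"
| "apply_arith Mul x y = x * y"
| "apply_arith Div x y = x / y"

fun numbers :: "event \<Rightarrow> real set" where
  "numbers (Arith f x y) = {x, y, apply_arith f x y}"
| "numbers (Compare x y) = {x, y}"

datatype 'x comp = Comp (result: 'x) (events: "event list")

definition return :: "'x \<Rightarrow> 'x comp" where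
  "return x = Comp x []"

definition bind_comp :: "'x comp \<Rightarrow> ('x \<Rightarrow> 'y comp) \<Rightarrow> 'y comp" where
  "bind_comp c k = Comp (result (k (result c))) (events c @ events (k (result c)))"

adhoc_overloading Monad_Syntax.bind \<rightleftharpoons> bind_comp

definition arith :: "arith \<Rightarrow> real \<Rightarrow> real \<Rightarrow> real comp" where
  "arith f x y = Comp (apply_arith f x y) [Arith f x y]"

definition leq :: "real \<Rightarrow> real \<Rightarrow> bool comp" where
  "leq x y = Comp (x \<le> y) [Compare x y]"

fun map_comp :: "('x \<Rightarrow> 'y comp) \<Rightarrow> 'x list \<Rightarrow> 'y list comp" where
  "map_comp f [] = return []"
| "map_comp f (x # xs) = do { y \<leftarrow> f x; ys \<leftarrow> map_comp f xs; return (y # ys) }"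

fun fold_comp :: "('s \<Rightarrow> 'x \<Rightarrow> 's comp) \<Rightarrow> 's \<Rightarrow> 'x list \<Rightarrow> 's comp" where
  "fold_comp f s [] = return s"
| "fold_comp f s (x # xs) = do { t \<leftarrow> f s x; fold_comp f t xs }"


section \<open>Linear system solvers\<close>

text \<open>A solver is an algebraic computation tree for each dimension. A tree works on a growing
  list of real registers: \<open>Compute f k l t\<close> appends the result of an operation on registers
  \<open>k\<close> and \<open>l\<close>, \<open>Test k l t u\<close> branches on whether register \<open>k\<close> is at most register \<open>l\<close>, and
  \<open>Output ks\<close> returns the values of the registers \<open>ks\<close>.\<close>

datatype comp_tree =
    Output "nat list"
  | Compute arith nat nat comp_tree
  | Test nat nat comp_tree comp_tree

primrec run_tree :: "comp_tree \<Rightarrow> real list \<Rightarrow> real list comp" where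
  "run_tree (Output ks) rs = return (map ((!) rs) ks)"
| "run_tree (Compute f k l t) rs =
     do { x \<leftarrow> arith f (rs ! k) (rs ! l); run_tree t (rs @ [x]) }"
| "run_tree (Test k l t u) rs =
     do { c \<leftarrow> leq (rs ! k) (rs ! l); if c then run_tree t rs else run_tree u rs }"

type_synonym solver = "nat \<Rightarrow> comp_tree"

text \<open>The input of a solver consists of the matrix, row by row, and the right-hand side,
  preceded by the constants \<open>0\<close> and \<open>1\<close>.\<close>

definition solve :: "solver \<Rightarrow> nat \<Rightarrow> real list \<Rightarrow> real list \<Rightarrow> real list comp" where
  "solve S n As bs = run_tree (S n) (0 # 1 # As @ bs)"

definition mat_entries :: "real mat \<Rightarrow> real list" where
  "mat_entries A = concat (map list_of_vec (rows A))"

definition strongly_polynomial_solver :: "solver \<Rightarrow> bool" where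
  "strongly_polynomial_solver S \<longleftrightarrow>
     (\<exists>p q :: nat poly. \<forall>n\<ge>1. \<forall>A\<in>carrier_mat n n. \<forall>b\<in>carrier_vec n. det A \<noteq> 0 \<longrightarrow>
        (let c = solve S n (mat_entries A) (list_of_vec b);
             input = mat_entries A @ list_of_vec b
         in length (result c) = n \<and> A *\<^sub>v vec_of_list (result c) = b \<and>
            length (events c) \<le> poly p n \<and>
            (set input \<subseteq> \<rat> \<longrightarrow>
               (\<forall>x \<in> set (result c) \<union> \<Union> (numbers ` set (events c)).
                  x \<in> \<rat> \<and> bit_size x \<le> poly q (total_bits input)))))"


section \<open>The computations within one iteration\<close>

text \<open>Fixed point of the affine map of a pair of policies, i.e. the solution of
  \<open>(1 - M) v = r\<close>.\<close>

definition fixpoint_comp ::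
    "solver \<Rightarrow> ('a, 'b) game \<Rightarrow> (nat \<Rightarrow> 'a) \<Rightarrow> (nat \<times> 'a \<Rightarrow> 'b) \<Rightarrow> real vec comp" where
  "fixpoint_comp S G \<sigma> \<delta> = (let n = nstates G; act = (\<lambda>i. \<delta> (i, \<sigma> i)) in do {
     As \<leftarrow> map_comp (\<lambda>i. map_comp (\<lambda>j. do {
              m \<leftarrow> arith Mul (disc G i (\<sigma> i) (act i)) (prob G i (\<sigma> i) (act i) j);
              arith Sub (if i = j then 1 else 0) m }) [0..<n]) [0..<n];
     xs \<leftarrow> solve S n (concat As) (map (\<lambda>i. pay G i (\<sigma> i) (act i)) [0..<n]);
     return (vec_of_list xs) })"

definition payoff_comp :: "('a, 'b) game \<Rightarrow> real vec \<Rightarrow> nat \<Rightarrow> 'a \<Rightarrow> 'b \<Rightarrow> real comp" where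
  "payoff_comp G v i a b = fold_comp (\<lambda>s j. do {
     m \<leftarrow> arith Mul (disc G i a b) (prob G i a b j);
     t \<leftarrow> arith Mul m (v $ j);
     arith Add s t }) (pay G i a b) [0..<nstates G]"

text \<open>Largest value with respect to the comparison \<open>cmp\<close>, and the list of all keys attaining
  it.\<close>

definition extremal_comp ::
    "(real \<Rightarrow> real \<Rightarrow> bool comp) \<Rightarrow> ('x \<times> real) list \<Rightarrow> (real \<times> 'x list) comp" where
  "extremal_comp cmp xs = do {
     m \<leftarrow> fold_comp (\<lambda>m (x, y). do { c \<leftarrow> cmp y m; return (if c then m else y) })
           (snd (hd xs)) (tl xs);
     cs \<leftarrow> map_comp (\<lambda>(x, y). cmp m y) xs;
     return (m, map (fst \<circ> fst) (filter snd (zip xs cs))) }"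

definition response_comp ::
    "('a, 'b) game \<Rightarrow> real vec \<Rightarrow> nat \<Rightarrow> 'a \<Rightarrow> (real \<times> 'b list) comp" where
  "response_comp G v i a = do {
     ys \<leftarrow> map_comp (payoff_comp G v i a) (acts2 G i);
     extremal_comp leq (zip (acts2 G i) ys) }"

definition eval_policy_comp ::
    "('a, 'b) game \<Rightarrow> (nat \<Rightarrow> 'a) \<Rightarrow> real vec \<Rightarrow> (real \<times> 'b list) list comp" where
  "eval_policy_comp G \<sigma> v = map_comp (\<lambda>i. response_comp G v i (\<sigma> i)) [0..<nstates G]"

text \<open>For each state, the responses to all actions of the first player, the minimum of their
  values, and the minimizing actions.\<close>

definition eval_comp ::
    "('a, 'b) game \<Rightarrow> real vec \<Rightarrow> ((real \<times> 'b list) list \<times> real \<times> 'a list) list comp" where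
  "eval_comp G v = map_comp (\<lambda>i. do {
     rs \<leftarrow> map_comp (response_comp G v i) (acts1 G i);
     e \<leftarrow> extremal_comp (\<lambda>x y. leq y x) (zip (acts1 G i) (map fst rs));
     return (rs, e) }) [0..<nstates G]"


section \<open>Policy iteration\<close>

text \<open>A nondeterministic transition system, so that all admissible choices of policies are
  covered. \<open>Outer \<sigma>\<close> is about to compute the fixed point of \<open>f_policy G \<sigma>\<close>; \<open>Inner \<sigma> \<delta>\<close> is
  about to compute the fixed point of \<open>f_policies G \<sigma> \<delta>\<close>; \<open>Improve2\<close> and \<open>Improve1\<close> are about
  to look for a new policy of the second and of the first player.

  The choices depend on the data only through the results of \<open>eval_policy_comp\<close> and
  \<open>eval_comp\<close> (see the lemmas at the end), and are free of arithmetic. The returned second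
  policy is the one of the inner iteration, completed at the actions not played by \<open>\<sigma>\<close> by
  the maximizers found when evaluating \<open>f_op G v\<close>.\<close>

datatype ('a, 'b) config =
    Outer "nat \<Rightarrow> 'a"
  | Inner "nat \<Rightarrow> 'a" "nat \<times> 'a \<Rightarrow> 'b"
  | Improve2 "nat \<Rightarrow> 'a" "nat \<times> 'a \<Rightarrow> 'b" "real vec"
  | Improve1 "nat \<Rightarrow> 'a" "nat \<times> 'a \<Rightarrow> 'b" "real vec"
  | Done "real vec" "nat \<Rightarrow> 'a" "nat \<times> 'a \<Rightarrow> 'b"

inductive pi_step ::
    "solver \<Rightarrow> ('a, 'b) game \<Rightarrow> ('a, 'b) config \<Rightarrow> event list \<Rightarrow> ('a, 'b) config \<Rightarrow> bool"
  for S G where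
  init2: "\<delta> \<in> policies2 G \<Longrightarrow> pi_step S G (Outer \<sigma>) [] (Inner \<sigma> \<delta>)"
| evaluate: "pi_step S G (Inner \<sigma> \<delta>) (events (fixpoint_comp S G \<sigma> \<delta>))
     (Improve2 \<sigma> \<delta> (result (fixpoint_comp S G \<sigma> \<delta>)))"
| stop2: "f_policy G \<sigma> v = f_policies G \<sigma> \<delta> v \<Longrightarrow>
     pi_step S G (Improve2 \<sigma> \<delta> v) (events (eval_policy_comp G \<sigma> v)) (Improve1 \<sigma> \<delta> v)"
| improve2: "f_policy G \<sigma> v \<noteq> f_policies G \<sigma> \<delta> v \<Longrightarrow>
     \<delta>' \<in> policies2 G \<Longrightarrow> f_policy G \<sigma> v = f_policies G \<sigma> \<delta>' v \<Longrightarrow>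
     pi_step S G (Improve2 \<sigma> \<delta> v) (events (eval_policy_comp G \<sigma> v)) (Inner \<sigma> \<delta>')"
| stop1: "f_op G v = f_policy G \<sigma> v \<Longrightarrow>
     \<delta>' \<in> policies2 G \<Longrightarrow> (\<forall>i<nstates G. \<delta>' (i, \<sigma> i) = \<delta> (i, \<sigma> i)) \<Longrightarrow>
     (\<forall>\<tau>\<in>policies1 G. f_policy G \<tau> v = f_policies G \<tau> \<delta>' v) \<Longrightarrow>
     pi_step S G (Improve1 \<sigma> \<delta> v) (events (eval_comp G v)) (Done v \<sigma> \<delta>')"
| improve1: "f_op G v \<noteq> f_policy G \<sigma> v \<Longrightarrow>
     \<sigma>' \<in> policies1 G \<Longrightarrow> f_op G v = f_policy G \<sigma>' v \<Longrightarrow>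
     pi_step S G (Improve1 \<sigma> \<delta> v) (events (eval_comp G v)) (Outer \<sigma>')"

text \<open>\<open>pi_run S G k l c\<close>: some run reaches \<open>c\<close> after \<open>k\<close> transitions with events \<open>l\<close>.\<close>

inductive pi_run ::
    "solver \<Rightarrow> ('a, 'b) game \<Rightarrow> nat \<Rightarrow> event list \<Rightarrow> ('a, 'b) config \<Rightarrow> bool"
  for S G where
  start: "\<sigma> \<in> policies1 G \<Longrightarrow> pi_run S G 0 [] (Outer \<sigma>)"
| step: "pi_run S G k l c \<Longrightarrow> pi_step S G c l' c' \<Longrightarrow> pi_run S G (Suc k) (l @ l') c'"

text \<open>The bound on \<open>k\<close> makes every run finite; by the last conjunct a run can only end in a
  solution.\<close>

definition solves_in_strongly_polynomial_time :: "solver \<Rightarrow> ('a, 'b) game set \<Rightarrow> bool" where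
  "solves_in_strongly_polynomial_time S \<G> \<longleftrightarrow>
     (\<exists>p q :: nat poly. \<forall>G\<in>\<G>. \<forall>k l c. pi_run S G k l c \<longrightarrow>
        k + length l \<le> poly p (nstates G + length (triples G)) \<and>
        (set (game_data G) \<subseteq> \<rat> \<longrightarrow>
           (\<forall>x \<in> \<Union> (numbers ` set l). x \<in> \<rat> \<and> bit_size x \<le> poly q (total_bits (game_data G)))) \<and>
        ((\<exists>l' c'. pi_step S G c l' c') \<or>
         (\<exists>v \<sigma> \<delta>. c = Done v \<sigma> \<delta> \<and> is_solution G v \<sigma> \<delta>)))"

section \<open>Results of the computations\<close>

lemma result_return [simp]: "result (return x) = x"
  by (simp add: return_def)

lemma result_bind [simp]: "result (bind_comp c k) = result (k (result c))"
  by (simp add: bind_comp_def)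

lemma result_arith [simp]: "result (arith f x y) = apply_arith f x y"
  by (simp add: arith_def)

lemma result_leq [simp]: "result (leq x y) \<longleftrightarrow> x \<le> y"
  by (simp add: leq_def)

lemma result_map_comp [simp]: "result (map_comp f xs) = map (\<lambda>x. result (f x)) xs"
  by (induction xs) auto

lemma result_fold_comp [simp]:
  "result (fold_comp f s xs) = foldl (\<lambda>s x. result (f s x)) s xs"
  by (induction xs arbitrary: s) auto

lemma foldl_add_sum: "foldl (\<lambda>s j. s + g j) (s :: real) [0..<n] = (\<Sum>j<n. g j) + s"
  by (induction n) auto

lemma result_payoff_comp [simp]: "result (payoff_comp G v i a b) = payoff G v i a b"
  by (simp add: payoff_comp_def payoff_def foldl_add_sum)

lemma filter_zip_map:
  "map (fst \<circ> fst) (filter snd (zip xs (map P xs))) = map fst (filter P xs)"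
  by (induction xs) auto

lemma foldl_Max:
  "foldl (\<lambda>m x. if snd x \<le> m then m else snd x) (s :: real) xs = Max (insert s (snd ` set xs))"
proof (induction xs arbitrary: s)
  case (Cons x xs)
  have "Max (insert (if snd x \<le> s then s else snd x) (snd ` set xs))
      = Max (insert s (insert (snd x) (snd ` set xs)))"
    by (cases "set xs = {}") (auto simp: max_def)
  then show ?case using Cons by simp
qed simp

lemma foldl_Min:
  "foldl (\<lambda>m x. if m \<le> snd x then m else snd x) (s :: real) xs = Min (insert s (snd ` set xs))"
proof (induction xs arbitrary: s)
  case (Cons x xs)
  have "Min (insert (if s \<le> snd x then s else snd x) (snd ` set xs))
      = Min (insert s (insert (snd x) (snd ` set xs)))"
    by (cases "set xs = {}") (auto simp: min_def)
  then show ?case using Cons by simp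
qed simp

lemma snd_hd_tl: "xs \<noteq> [] \<Longrightarrow> insert (snd (hd xs)) (snd ` set (tl xs)) = snd ` set xs"
  by (cases xs) auto

lemma result_extremal_max:
  assumes "xs \<noteq> []"
  shows "result (extremal_comp leq xs) =
    (Max (snd ` set xs), map fst (filter (\<lambda>x. snd x = Max (snd ` set xs)) xs))"
proof -
  have m: "foldl (\<lambda>m x. if snd x \<le> m then m else snd x) (snd (hd xs)) (tl xs) = Max (snd ` set xs)"
    unfolding foldl_Max snd_hd_tl[OF assms] ..
  have "filter (\<lambda>x. Max (snd ` set xs) \<le> snd x) xs = filter (\<lambda>x. snd x = Max (snd ` set xs)) xs"
    by (rule filter_cong) (force intro: antisym Max_ge)+
  then show ?thesis
    by (simp add: extremal_comp_def case_prod_beta filter_zip_map m if_distrib[of result] cong: if_cong)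
qed

lemma result_extremal_min:
  assumes "xs \<noteq> []"
  shows "result (extremal_comp (\<lambda>x y. leq y x) xs) =
    (Min (snd ` set xs), map fst (filter (\<lambda>x. snd x = Min (snd ` set xs)) xs))"
proof -
  have m: "foldl (\<lambda>m x. if m \<le> snd x then m else snd x) (snd (hd xs)) (tl xs) = Min (snd ` set xs)"
    unfolding foldl_Min snd_hd_tl[OF assms] ..
  have "filter (\<lambda>x. snd x \<le> Min (snd ` set xs)) xs = filter (\<lambda>x. snd x = Min (snd ` set xs)) xs"
    by (rule filter_cong) (force intro: antisym Min_le)+
  then show ?thesis
    by (simp add: extremal_comp_def case_prod_beta filter_zip_map m if_distrib[of result] cong: if_cong)
qed

lemma filter_zip_keys: "map fst (filter (\<lambda>x. snd x = c) (zip xs (map g xs))) = filter (\<lambda>x. g x = c) xs"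
  by (induction xs) auto

lemma snd_zip_map: "snd ` set (zip xs (map g xs)) = g ` set xs"
  by (induction xs) auto

lemma result_response_comp:
  assumes "acts2 G i \<noteq> []"
  shows "result (response_comp G v i a) =
    (let m = Max (payoff G v i a ` set (acts2 G i))
     in (m, filter (\<lambda>b. payoff G v i a b = m) (acts2 G i)))"
  using assms
  by (simp add: response_comp_def Let_def result_extremal_max snd_zip_map filter_zip_keys)

lemma f_policies_index:
  assumes "v \<in> carrier_vec (nstates G)" "i < nstates G"
  shows "f_policies G \<sigma> \<delta> v $ i = payoff G v i (\<sigma> i) (\<delta> (i, \<sigma> i))"
  using assms
  by (auto simp: f_policies_def trans_mat_def pay_vec_def payoff_def scalar_prod_def
      atLeast0LessThan intro!: sum.cong)

lemma f_policy_index: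
  assumes "game_instance G" "v \<in> carrier_vec (nstates G)" "i < nstates G"
  shows "f_policy G \<sigma> v $ i = Max (payoff G v i (\<sigma> i) ` set (acts2 G i))"
proof -
  have img: "(\<lambda>\<delta>. \<delta> (i, \<sigma> i)) ` policies2 G = set (acts2 G i)"
  proof (intro subset_antisym subsetI)
    fix b assume b: "b \<in> set (acts2 G i)"
    define d where "d = (\<lambda>(j, a :: 'a)\<in>{..<nstates G} \<times> UNIV. if j = i then b else hd (acts2 G j))"
    have "d (j, a) \<in> set (acts2 G j)" if "j < nstates G" for j a
      using that b assms(1) unfolding d_def game_instance_def by simp
    moreover have "d x = undefined" if "x \<notin> {..<nstates G} \<times> UNIV" for x
      using that unfolding d_def by (rule restrict_apply[THEN trans, OF if_not_P])
    ultimately have "d \<in> policies2 G"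
      unfolding policies2_def by (intro PiE_I) blast+
    moreover have "d (i, \<sigma> i) = b" using assms(3) by (simp add: d_def)
    ultimately show "b \<in> (\<lambda>\<delta>. \<delta> (i, \<sigma> i)) ` policies2 G" by blast
  next
    fix b assume "b \<in> (\<lambda>\<delta>. \<delta> (i, \<sigma> i)) ` policies2 G"
    then obtain \<delta> where "\<delta> \<in> policies2 G" and b: "b = \<delta> (i, \<sigma> i)" by blast
    from PiE_mem[OF this(1)[unfolded policies2_def], of "(i, \<sigma> i)"]
    show "b \<in> set (acts2 G i)" using assms(3) b by simp
  qed
  have "f_policy G \<sigma> v $ i = Max ((\<lambda>\<delta>. payoff G v i (\<sigma> i) (\<delta> (i, \<sigma> i))) ` policies2 G)"
    using assms(3) by (simp add: f_policy_def f_policies_index[OF assms(2,3)])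
  then show ?thesis unfolding img[symmetric] image_image .
qed

lemma result_eval_policy_comp:
  assumes "game_instance G" "v \<in> carrier_vec (nstates G)" "i < nstates G"
  shows "result (eval_policy_comp G \<sigma> v) ! i =
    (f_policy G \<sigma> v $ i, filter (\<lambda>b. payoff G v i (\<sigma> i) b = f_policy G \<sigma> v $ i) (acts2 G i))"
  using assms
  by (simp add: eval_policy_comp_def result_response_comp f_policy_index game_instance_def Let_def)

lemma result_eval_comp:
  assumes "game_instance G" "i < nstates G"
  shows "result (eval_comp G v) ! i =
    (let g = (\<lambda>a. Max (payoff G v i a ` set (acts2 G i)))
     in (map (\<lambda>a. (g a, filter (\<lambda>b. payoff G v i a b = g a) (acts2 G i))) (acts1 G i),
         f_op G v $ i, filter (\<lambda>a. g a = f_op G v $ i) (acts1 G i)))"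
proof -
  have ne: "acts1 G i \<noteq> []" "acts2 G i \<noteq> []"
    using assms by (auto simp: game_instance_def)
  then show ?thesis
    using assms(2)
    by (simp add: eval_comp_def f_op_def result_response_comp Let_def comp_def
        result_extremal_min snd_zip_map filter_zip_keys)
qed

lemma maximizing_policies:
  assumes "game_instance G" "v \<in> carrier_vec (nstates G)"
  shows "f_policy G \<sigma> v = f_policies G \<sigma> \<delta> v \<longleftrightarrow>
    (\<forall>i<nstates G. payoff G v i (\<sigma> i) (\<delta> (i, \<sigma> i)) = f_policy G \<sigma> v $ i)"
proof -
  have "dim_vec (f_policy G \<sigma> v) = nstates G" "dim_vec (f_policies G \<sigma> \<delta> v) = nstates G"
    by (simp_all add: f_policy_def f_policies_def pay_vec_def)
  then show ?thesis
    using f_policies_index[OF assms(2)] by (auto simp: vec_eq_iff)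
qed

lemma minimizing_policies:
  assumes "game_instance G" "v \<in> carrier_vec (nstates G)"
  shows "f_op G v = f_policy G \<sigma> v \<longleftrightarrow>
    (\<forall>i<nstates G. Max (payoff G v i (\<sigma> i) ` set (acts2 G i)) = f_op G v $ i)"
proof -
  have "dim_vec (f_policy G \<sigma> v) = nstates G" "dim_vec (f_op G v) = nstates G"
    by (simp_all add: f_policy_def f_op_def)
  then show ?thesis
    using f_policy_index[OF assms] by (auto simp: vec_eq_iff)
qed

end

theory Submission
  imports Defs
begin

text \<open>Put \<open>\<mu> = (1 + \<lambda>) / 2\<close>. Maximizing over all pairs of policies the solution of
  \<open>\<mu> u = M u + 1\<close> yields one positive vector \<open>u\<close> with \<open>M u \<le> \<mu> u\<close> for all transition
  matrices at once, so that all operators of the game are monotone and contract by \<open>\<mu>\<close> in the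
  sup norm weighted by \<open>u\<close>. In policy iteration the distance to the value then decays like
  \<open>\<mu>^s\<close>, whereas it is comparable, up to the factor \<open>1 - \<mu>\<close>, to the largest reduced cost of
  an action in use. Hence an action of largest reduced cost is never used again after \<open>L\<close>
  iterations, where \<open>\<mu>^L < 1 - \<mu>\<close>, and the number of iterations is at most \<open>L\<close> times the
  number of actions. This applies to the outer and to each inner iteration. The linear system of
  an iteration is made from the input, not from earlier iterates, so bit sizes do not build up.\<close>


section \<open>Policy iteration for contracting operators\<close>

text \<open>The spectral radius bound speaks of each transition matrix separately and gives no norm
  in which the whole game contracts; with discount factors above 1 the plain sup norm need not
  contract at all. Two facts lead to common weights. The second player sees the action of the first,
  so every choice of one action pair per state is played by some pair of policies, and the
  maximization defining \<open>u\<close> never leaves the matrices covered by the hypothesis. Its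
  optimum must moreover be found before any contraction is available: it comes from the finitely
  many policies by a comparison principle that nonnegativity and the spectral radius already supply.
  The factor \<open>\<mu>\<close> lies above \<open>lam\<close> because a reducible matrix of
  spectral radius \<open>lam\<close> may have no positive \<open>u\<close> with \<open>M u\<close>
  at most \<open>lam u\<close>. Since \<open>u\<close> and \<open>\<mu>\<close> belong to the game
  as a whole, every inner iteration inherits them, whatever the policy of the first player; thus
  \<open>L\<close> depends on \<open>lam\<close> only, and the product of the two iteration counts
  stays polynomial.\<close>

lemma Min_image_attained:
  assumes "finite A" "A \<noteq> {}"
  shows "\<exists>a\<in>A. f a = Min (f ` A)"
proof -
  have "Min (f ` A) \<in> f ` A" using assms by (intro Min_in) auto
  then show ?thesis by (metis imageE)
qed

text \<open>Among the finitely many policies take one whose value has the least coordinate sum. The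
  policy greedy for this value has a value that is pointwise no larger, so minimality of the sum
  forces equality, and greediness then yields the fixed point of the minimum. No norm enters, only
  solvability and the comparison \<open>least\<close>; this allows the use for constructing the
  weights themselves.\<close>

lemma optimal_policy_value:
  fixes g :: "nat \<Rightarrow> 'c \<Rightarrow> (nat \<Rightarrow> real) \<Rightarrow> real"
  assumes C: "\<And>i. i < n \<Longrightarrow> finite (C i)" "\<And>i. i < n \<Longrightarrow> C i \<noteq> {}"
    and evaluable: "\<And>\<pi>. \<pi> \<in> PiE {..<n} C \<Longrightarrow> \<exists>v. \<forall>i<n. g i (\<pi> i) v = v i"
    and least: "\<And>\<pi> v x i. \<pi> \<in> PiE {..<n} C \<Longrightarrow> \<forall>i<n. g i (\<pi> i) v = v i \<Longrightarrow>
      \<forall>i<n. g i (\<pi> i) x \<le> x i \<Longrightarrow> i < n \<Longrightarrow> v i \<le> x i"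
    and cong: "\<And>i c v w. i < n \<Longrightarrow> c \<in> C i \<Longrightarrow> \<forall>j<n. v j = w j \<Longrightarrow> g i c v = g i c w"
  shows "\<exists>v. \<forall>i<n. Min ((\<lambda>c. g i c v) ` C i) = v i"
proof -
  let ?P = "PiE {..<n} C"
  obtain V where V: "\<And>\<pi>. \<pi> \<in> ?P \<Longrightarrow> \<forall>i<n. g i (\<pi> i) (V \<pi>) = V \<pi> i"
    using evaluable by metis
  have "finite ?P" "?P \<noteq> {}"
    using C by (auto intro: finite_PiE simp: PiE_eq_empty_iff)
  then obtain \<pi> where \<pi>: "\<pi> \<in> ?P"
    and min: "\<And>\<rho>. \<rho> \<in> ?P \<Longrightarrow> (\<Sum>i<n. V \<pi> i) \<le> (\<Sum>i<n. V \<rho> i)"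
    using ex_is_arg_min_if_finite[of ?P "\<lambda>\<pi>. \<Sum>i<n. V \<pi> i"]
    by (auto simp: is_arg_min_linorder)
  let ?v = "V \<pi>"
  let ?F = "\<lambda>i. Min ((\<lambda>c. g i c ?v) ` C i)"
  have "\<exists>c\<in>C i. g i c ?v = ?F i" if "i < n" for i
    using C[OF that] by (intro Min_image_attained)
  then obtain r where r: "\<And>i. i < n \<Longrightarrow> r i \<in> C i \<and> g i (r i) ?v = ?F i"
    by metis
  define \<rho> where "\<rho> = restrict r {..<n}"
  have \<rho>: "\<rho> \<in> ?P" using r by (auto simp: \<rho>_def)
  have opt: "g i (\<rho> i) ?v = ?F i" if "i < n" for i using r that by (simp add: \<rho>_def)
  have "g i (\<rho> i) ?v \<le> ?v i" if "i < n" for i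
  proof -
    have "?F i \<le> g i (\<pi> i) ?v"
      using \<pi> C[OF that] that by (intro Min_le) auto
    then show ?thesis using V[OF \<pi>] opt that by simp
  qed
  then have le: "V \<rho> i \<le> ?v i" if "i < n" for i
    using least[OF \<rho> V[OF \<rho>]] that by blast
  have eq: "V \<rho> i = ?v i" if "i < n" for i
  proof (rule ccontr)
    assume "V \<rho> i \<noteq> ?v i"
    then have "(\<Sum>i<n. V \<rho> i) < (\<Sum>i<n. ?v i)"
      using le that by (intro sum_strict_mono_ex1) (auto intro!: bexI[of _ i] simp: less_le)
    with min[OF \<rho>] show False by simp
  qed
  have "?F i = ?v i" if "i < n" for i
  proof -
    have "\<rho> i \<in> C i" using \<rho> that by auto
    from cong[OF that this, of ?v "V \<rho>"] show ?thesis
      using V[OF \<rho>] opt eq that by simp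
  qed
  then show ?thesis by blast
qed

text \<open>The condition \<open>step\<close> with \<open>t = 0\<close> is monotonicity; in general it also gives contraction by
  the factor \<open>\<mu>\<close> in the sup norm with weights \<open>u\<close>.\<close>

locale contracting_game =
  fixes n :: nat and C :: "nat \<Rightarrow> 'c set" and g :: "nat \<Rightarrow> 'c \<Rightarrow> (nat \<Rightarrow> real) \<Rightarrow> real"
    and u :: "nat \<Rightarrow> real" and \<mu> :: real
  assumes actions: "\<And>i. i < n \<Longrightarrow> finite (C i)" "\<And>i. i < n \<Longrightarrow> C i \<noteq> {}"
    and weights: "\<And>i. i < n \<Longrightarrow> 0 < u i"
    and factor: "0 \<le> \<mu>" "\<mu> < 1"
    and step: "\<And>i c v w t. i < n \<Longrightarrow> c \<in> C i \<Longrightarrow> 0 \<le> t \<Longrightarrow> \<forall>j<n. v j \<le> w j + t * u j \<Longrightarrow>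
      g i c v \<le> g i c w + \<mu> * t * u i"
begin

definition F :: "(nat \<Rightarrow> real) \<Rightarrow> nat \<Rightarrow> real" where
  "F v i = Min ((\<lambda>c. g i c v) ` C i)"

lemma F_le: "i < n \<Longrightarrow> c \<in> C i \<Longrightarrow> F v i \<le> g i c v"
  using actions by (simp add: F_def)

lemma F_attained: "i < n \<Longrightarrow> \<exists>c\<in>C i. g i c v = F v i"
  unfolding F_def by (intro Min_image_attained actions)

lemma F_step:
  assumes "i < n" "0 \<le> t" "\<forall>j<n. v j \<le> w j + t * u j"
  shows "F v i \<le> F w i + \<mu> * t * u i"
proof -
  obtain c where "c \<in> C i" "g i c w = F w i" using F_attained[OF assms(1)] by blast
  with F_le[OF assms(1) this(1), of v] step[OF assms(1) this(1) assms(2,3)] show ?thesis by simp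
qed

lemma g_mono: "i < n \<Longrightarrow> c \<in> C i \<Longrightarrow> \<forall>j<n. v j \<le> w j \<Longrightarrow> g i c v \<le> g i c w"
  using step[of i c 0 v w] by simp

lemma g_cong: "i < n \<Longrightarrow> c \<in> C i \<Longrightarrow> \<forall>j<n. v j = w j \<Longrightarrow> g i c v = g i c w"
  using g_mono[of i c v w] g_mono[of i c w v] by simp

lemma F_cong:
  assumes "i < n" "\<forall>j<n. v j = w j"
  shows "F v i = F w i"
  unfolding F_def using g_cong assms by (intro arg_cong[where f = Min] image_cong) auto

text \<open>Let \<open>t\<close> be the largest excess of \<open>v\<close> over \<open>w\<close> in
  units of \<open>u\<close>, attained at \<open>k\<close>. If it were positive, \<open>sub\<close>,
  the contraction and \<open>super\<close> would give \<open>t * u k \<le> \<mu> * t * u k\<close>,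
  which \<open>\<mu> < 1\<close> forbids. The operator \<open>h\<close> is abstract in order to
  cover both a single policy and the minimum \<open>F\<close>.\<close>

lemma comparison:
  assumes h: "\<And>i v w t. i < n \<Longrightarrow> 0 \<le> t \<Longrightarrow> \<forall>j<n. v j \<le> w j + t * u j \<Longrightarrow>
      h i v \<le> h i w + \<mu> * t * u i"
    and sub: "\<And>i. i < n \<Longrightarrow> v i \<le> h i v" and super: "\<And>i. i < n \<Longrightarrow> h i w \<le> w i"
    and i: "i < n"
  shows "v i \<le> w i"
proof -
  define t where "t = Max ((\<lambda>i. (v i - w i) / u i) ` {..<n})"
  have "t \<in> (\<lambda>i. (v i - w i) / u i) ` {..<n}"
    unfolding t_def using i by (intro Max_in) auto
  then obtain k where k: "k < n" "t = (v k - w k) / u k" by auto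
  have le: "v j \<le> w j + t * u j" if "j < n" for j
  proof -
    have "(v j - w j) / u j \<le> t" unfolding t_def using that by (intro Max_ge) auto
    then show ?thesis using weights[OF that] by (simp add: field_simps)
  qed
  have "t \<le> 0"
  proof (rule ccontr)
    assume "\<not> t \<le> 0"
    then have t: "0 < t" by simp
    have "v k \<le> w k + \<mu> * t * u k"
      using h[OF k(1), of t v w] sub[OF k(1)] super[OF k(1)] t le by simp
    moreover have "v k = w k + t * u k" using k weights[OF k(1)] by simp
    ultimately have "t * u k \<le> \<mu> * (t * u k)" by simp
    moreover have "\<mu> * (t * u k) < 1 * (t * u k)"
      using t weights[OF k(1)] factor by (intro mult_strict_right_mono) auto
    ultimately show False by simp
  qed
  then have "t * u i \<le> 0" using weights[OF i] by (simp add: mult_le_0_iff)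
  with le[OF i] show ?thesis by simp
qed

lemma policy_comparison:
  assumes "\<And>i. i < n \<Longrightarrow> \<pi> i \<in> C i"
    and "\<And>i. i < n \<Longrightarrow> v i \<le> g i (\<pi> i) v" and "\<And>i. i < n \<Longrightarrow> g i (\<pi> i) w \<le> w i"
    and "i < n"
  shows "v i \<le> w i"
  using comparison[of "\<lambda>i. g i (\<pi> i)" v w i] step assms by blast

text \<open>Fixed points of the policies are left as a hypothesis because their source differs:
  linear algebra for the inner game, the value of an inner game for the outer one.\<close>

lemma value_exists:
  assumes "\<And>\<pi>. \<pi> \<in> PiE {..<n} C \<Longrightarrow> \<exists>v. \<forall>i<n. g i (\<pi> i) v = v i"
  shows "\<exists>v. \<forall>i<n. F v i = v i"
  unfolding F_def
proof (rule optimal_policy_value[OF actions assms])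
  fix \<pi> v x i
  assume "\<pi> \<in> PiE {..<n} C" "\<forall>i<n. g i (\<pi> i) v = v i" "\<forall>i<n. g i (\<pi> i) x \<le> x i" "i < n"
  then show "v i \<le> x i" by (intro policy_comparison[of \<pi> v x]) auto
qed (use g_cong in auto)

lemma value_unique:
  assumes "\<And>i. i < n \<Longrightarrow> F v i = v i" "\<And>i. i < n \<Longrightarrow> F w i = w i" "i < n"
  shows "v i = w i"
  using comparison[of "\<lambda>i v. F v i" v w i] comparison[of "\<lambda>i v. F v i" w v i] F_step assms
  by (simp add: order_antisym)

text \<open>The reduced costs \<open>g i c z - z i\<close> of the actions used by the policy iterates are, up to the
  factor \<open>1 / (1 - \<mu>)\<close>, as large as the distance of the iterate to the value \<open>z\<close>, which decays
  geometrically. So after \<open>L\<close> iterations the costliest action in use has been given up for good.\<close>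

context
  fixes K :: nat and \<pi> :: "nat \<Rightarrow> nat \<Rightarrow> 'c" and v :: "nat \<Rightarrow> nat \<Rightarrow> real"
    and z :: "nat \<Rightarrow> real" and L :: nat
  assumes policy: "\<And>s i. s < K \<Longrightarrow> i < n \<Longrightarrow> \<pi> s i \<in> C i"
    and evaluated: "\<And>s i. s < K \<Longrightarrow> i < n \<Longrightarrow> g i (\<pi> s i) (v s) = v s i"
    and improved: "\<And>s i. Suc s < K \<Longrightarrow> i < n \<Longrightarrow> g i (\<pi> (Suc s) i) (v s) = F (v s) i"
    and unfinished: "\<And>s. s < K \<Longrightarrow> \<exists>i<n. F (v s) i \<noteq> v s i"
    and z: "\<And>i. i < n \<Longrightarrow> F z i = z i"
    and L: "\<mu> ^ L < 1 - \<mu>"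
begin

text \<open>The minimum lies below every policy operator, so \<open>z\<close> is a subsolution for
  \<open>\<pi> s\<close>, whose fixed point is \<open>v s\<close>.\<close>

lemma iterate_above_value:
  assumes "s < K" "i < n"
  shows "z i \<le> v s i"
proof (rule policy_comparison[of "\<pi> s"])
  fix j assume "j < n"
  then show "z j \<le> g j (\<pi> s j) z" using F_le[of j "\<pi> s j" z] z policy assms by simp
qed (use policy evaluated assms in auto)

text \<open>A step of policy iteration gains at least as much as a step of value iteration. The new
  policy maps \<open>v s\<close> to \<open>F (v s)\<close>, which is below \<open>v s\<close>; hence
  its fixed point is below \<open>v s\<close>, and monotonicity carries this one application
  further.\<close>

lemma iterate_step:
  assumes "Suc s < K" "i < n"
  shows "v (Suc s) i \<le> F (v s) i"
proof -
  have F: "F (v s) j \<le> v s j" if "j < n" for j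
    using F_le[of j "\<pi> s j" "v s"] policy[of s j] evaluated[of s j] that assms(1) by simp
  have "v (Suc s) j \<le> v s j" if "j < n" for j
    by (rule policy_comparison[of "\<pi> (Suc s)" "v (Suc s)" "v s"])
      (use policy evaluated improved assms F that in auto)
  then have "g i (\<pi> (Suc s) i) (v (Suc s)) \<le> g i (\<pi> (Suc s) i) (v s)"
    using g_mono policy assms by simp
  then show ?thesis using evaluated improved assms by simp
qed

text \<open>Domination by value iteration transfers the contraction of \<open>F\<close> towards its
  fixed point \<open>z\<close> to the policy iterates.\<close>

lemma iterate_decay:
  assumes "s + k < K" "0 \<le> t" "\<And>i. i < n \<Longrightarrow> v s i \<le> z i + t * u i" "i < n"
  shows "v (s + k) i \<le> z i + \<mu> ^ k * t * u i"
  using assms(1,4)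
proof (induction k arbitrary: i)
  case (Suc k)
  have "v (s + Suc k) i \<le> F (v (s + k)) i"
    using iterate_step[of "s + k" i] Suc.prems by simp
  also have "\<dots> \<le> F z i + \<mu> * (\<mu> ^ k * t) * u i"
    using Suc assms(2) factor by (intro F_step) auto
  finally show ?case using z Suc.prems by (simp add: mult.assoc)
qed (use assms in simp)

lemma action_eliminated:
  assumes s: "s < K"
  shows "\<exists>i<n. \<forall>s'. s + L \<le> s' \<and> s' < K \<longrightarrow> \<pi> s' i \<noteq> \<pi> s i"
proof -
  define e where "e i = g i (\<pi> s i) z - z i" for i
  have e0: "0 \<le> e i" if "i < n" for i
    using F_le[of i "\<pi> s i" z] z policy s that by (simp add: e_def)
  have n: "0 < n" using unfinished[OF s] by auto
  define t where "t = Max ((\<lambda>i. e i / u i) ` {..<n})"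
  have "t \<in> (\<lambda>i. e i / u i) ` {..<n}"
    unfolding t_def using n by (intro Max_in) auto
  then obtain i where i: "i < n" "t = e i / u i" by auto
  have le: "e j \<le> t * u j" if "j < n" for j
  proof -
    have "e j / u j \<le> t" unfolding t_def using that by (intro Max_ge) auto
    then show ?thesis using weights[OF that] by (simp add: field_simps)
  qed
  have "0 \<le> t" using i e0 weights[OF i(1)] by simp
  \<comment> \<open>If all reduced costs vanished, \<open>z\<close> would be a fixed point of the
    current policy and so coincide with \<open>v s\<close>, against
    \<open>unfinished\<close>.\<close>
  moreover have "t \<noteq> 0"
  proof
    assume "t = 0"
    then have fix_z: "g j (\<pi> s j) z = z j" if "j < n" for j
      using le[OF that] e0[OF that] by (simp add: e_def)
    have "v s j \<le> z j" if "j < n" for j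
      by (rule policy_comparison[of "\<pi> s" "v s" z]) (use policy evaluated fix_z s that in auto)
    then have "v s j = z j" if "j < n" for j
      using iterate_above_value[OF s that] that by (simp add: order_antisym)
    then have "F (v s) j = v s j" if "j < n" for j
      using F_cong[of j "v s" z] z that by simp
    with unfinished[OF s] show False by blast
  qed
  ultimately have t: "0 < t" by simp
  \<comment> \<open>The vector \<open>z + t / (1 - \<mu>) * u\<close> is a supersolution for
    \<open>\<pi> s\<close>: applying the operator costs at most \<open>t * u\<close> for the reduced
    costs and \<open>\<mu> * t / (1 - \<mu>) * u\<close> for the shift, and these add up to the
    shift again.\<close>
  have first: "v s j \<le> z j + t / (1 - \<mu>) * u j" if "j < n" for j
  proof (rule policy_comparison[of "\<pi> s"])
    fix j assume j: "j < n"
    have "g j (\<pi> s j) (\<lambda>j. z j + t / (1 - \<mu>) * u j)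
        \<le> g j (\<pi> s j) z + \<mu> * (t / (1 - \<mu>)) * u j"
      using j policy s t factor by (intro step) auto
    also have "\<dots> \<le> z j + t * u j + \<mu> * (t / (1 - \<mu>)) * u j"
      using le[OF j] by (simp add: e_def)
    also have "t * u j + \<mu> * (t / (1 - \<mu>)) * u j = t / (1 - \<mu>) * u j"
      using factor by (simp add: field_simps)
    then have "z j + t * u j + \<mu> * (t / (1 - \<mu>)) * u j = z j + t / (1 - \<mu>) * u j"
      by simp
    finally show "g j (\<pi> s j) (\<lambda>j. z j + t / (1 - \<mu>) * u j) \<le> z j + t / (1 - \<mu>) * u j" .
  qed (use policy evaluated s that in auto)
  have "0 \<le> t / (1 - \<mu>)" using t factor by simp
  have "\<pi> s' i \<noteq> \<pi> s i" if s': "s + L \<le> s'" "s' < K" for s'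
  proof -
    define k where "k = s' - s"
    have k: "s' = s + k" "L \<le> k" using s' by (auto simp: k_def)
    \<comment> \<open>The reduced cost at \<open>i\<close> of whatever action
      \<open>\<pi> s'\<close> uses there is at most the distance \<open>v s' i - z i\<close>. By the
      choice of \<open>L\<close> this is strictly below \<open>e i\<close>, the reduced cost of the
      old action.\<close>
    have "g i (\<pi> s' i) z \<le> g i (\<pi> s' i) (v s')"
      using g_mono iterate_above_value policy s' i by simp
    also have "\<dots> = v s' i" using evaluated s' i by simp
    also have "\<dots> \<le> z i + \<mu> ^ k * (t / (1 - \<mu>)) * u i"
      unfolding k(1) using k(1) s'(2) \<open>0 \<le> t / (1 - \<mu>)\<close> first i(1) by (intro iterate_decay) simp_all
    also have "\<mu> ^ k * (t / (1 - \<mu>)) * u i \<le> \<mu> ^ L * (t / (1 - \<mu>)) * u i"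
      using k t factor weights[OF i(1)] by (intro mult_right_mono power_decreasing) auto
    also have "\<mu> ^ L * (t / (1 - \<mu>)) * u i < (1 - \<mu>) * (t / (1 - \<mu>)) * u i"
      using L t factor weights[OF i(1)] by (intro mult_strict_right_mono) auto
    also have "(1 - \<mu>) * (t / (1 - \<mu>)) * u i = e i"
      using i weights[OF i(1)] factor by simp
    finally have "g i (\<pi> s' i) z < g i (\<pi> s i) z" by (simp add: e_def)
    then show ?thesis by auto
  qed
  with i show ?thesis by blast
qed

text \<open>Look only at the iterations that are multiples of \<open>L\<close>. Each of them
  discards a pair of a state and an action for all later ones, so the discarded pairs are distinct;
  \<open>?m + 1\<close> such iterations would exhaust more than the \<open>?m\<close> existing
  pairs.\<close>

lemma policy_iteration_bound: "K \<le> L * (\<Sum>i<n. card (C i))"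
proof (rule ccontr)
  let ?m = "\<Sum>i<n. card (C i)"
  assume "\<not> ?thesis"
  then have K: "L * ?m < K" by simp
  have L0: "0 < L" using L factor by (cases L) auto
  have lt: "k * L < K" if "k \<le> ?m" for k
  proof -
    have "k * L \<le> ?m * L" using that by (rule mult_le_mono1)
    then show ?thesis using K by (metis le_less_trans mult.commute)
  qed
  then have "\<exists>i<n. \<forall>s'. k * L + L \<le> s' \<and> s' < K \<longrightarrow> \<pi> s' i \<noteq> \<pi> (k * L) i" if "k \<le> ?m" for k
    using action_eliminated that by blast
  then obtain x where x: "\<And>k. k \<le> ?m \<Longrightarrow> x k < n"
    and elim: "\<And>k s'. k \<le> ?m \<Longrightarrow> k * L + L \<le> s' \<Longrightarrow> s' < K \<Longrightarrow> \<pi> s' (x k) \<noteq> \<pi> (k * L) (x k)"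
    by metis
  let ?p = "\<lambda>k. (x k, \<pi> (k * L) (x k))"
  have "?p k \<noteq> ?p l" if "k < l" "l \<le> ?m" for k l
  proof -
    have "k * L + L \<le> l * L" using that mult_right_mono[of "Suc k" l L] by simp
    then show ?thesis using elim[of k "l * L"] lt[of l] that by auto
  qed
  then have "inj_on ?p {..?m}"
    by (intro linorder_inj_onI) auto
  moreover have "?p ` {..?m} \<subseteq> Sigma {..<n} C"
    using x policy lt by auto
  ultimately have "card {..?m} \<le> card (Sigma {..<n} C)"
    using actions by (intro card_inj_on_le) (auto intro: finite_SigmaI)
  also have "\<dots> = ?m" using actions by (simp add: card_SigmaI)
  finally show False by simp
qed

end

end


section \<open>Nonnegative matrices of small spectral radius\<close>

text \<open>Dividing the eigenvalue equation of the scaled matrix by \<open>c\<close> exhibits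
  \<open>k / c\<close> as an eigenvalue of \<open>A\<close>.\<close>

lemma spectral_radius_smult_le:
  fixes A :: "complex mat"
  assumes A: "A \<in> carrier_mat n n" and n: "0 < n" and c: "0 < c"
  shows "spectral_radius (complex_of_real c \<cdot>\<^sub>m A) \<le> c * spectral_radius A"
proof -
  have "complex_of_real c \<cdot>\<^sub>m A \<in> carrier_mat n n"
    using A by simp
  from spectral_radius_mem_max(1)[OF this n]
  obtain k where k: "eigenvalue (complex_of_real c \<cdot>\<^sub>m A) k"
    and r: "spectral_radius (complex_of_real c \<cdot>\<^sub>m A) = norm k"
    by (auto simp: spectrum_def)
  from k obtain v where v: "v \<in> carrier_vec n" "v \<noteq> 0\<^sub>v n"
    "(complex_of_real c \<cdot>\<^sub>m A) *\<^sub>v v = k \<cdot>\<^sub>v v"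
    using A by (auto simp: eigenvalue_def eigenvector_def)
  have "A *\<^sub>v v = (k / complex_of_real c) \<cdot>\<^sub>v v"
  proof (rule eq_vecI)
    fix i assume i: "i < dim_vec ((k / complex_of_real c) \<cdot>\<^sub>v v)"
    then have "((complex_of_real c \<cdot>\<^sub>m A) *\<^sub>v v) $ i = (k \<cdot>\<^sub>v v) $ i"
      using v(3) by simp
    then have "complex_of_real c * (row A i \<bullet> v) = k * v $ i"
      using i v(1) A by (simp add: row_smult smult_scalar_prod_distrib[of _ n])
    then show "(A *\<^sub>v v) $ i = ((k / complex_of_real c) \<cdot>\<^sub>v v) $ i"
      using i v A c by (simp add: field_simps)
  qed (use A v in simp)
  then have "eigenvalue A (k / complex_of_real c)"
    using A v by (auto simp: eigenvalue_def eigenvector_def)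
  then have "norm (k / complex_of_real c) \<le> spectral_radius A"
    by (intro spectral_radius_mem_max(2)[OF A n]) (auto simp: spectrum_def)
  then show ?thesis
    using c by (simp add: r norm_divide field_simps)
qed

lemma pow_mat_mult_vec:
  assumes "A \<in> carrier_mat n n" "x \<in> carrier_vec n"
  shows "(A ^\<^sub>m k) *\<^sub>v x = (((*\<^sub>v) A) ^^ k) x"
  using assms(2)
proof (induction k arbitrary: x)
  case (Suc k)
  have "A ^\<^sub>m Suc k *\<^sub>v x = (A ^\<^sub>m k) *\<^sub>v (A *\<^sub>v x)"
    using assms(1) Suc.prems by (simp add: pow_carrier_mat[OF assms(1)] assoc_mult_mat_vec[of _ n n _ n])
  also have "\<dots> = (((*\<^sub>v) A) ^^ k) (A *\<^sub>v x)"
    using assms(1) Suc by simp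
  finally show ?case by (simp add: funpow_swap1)
qed (use assms in simp)

text \<open>The bound from the Jordan normal form concerns complex matrices; the real powers embed
  entrywise and keep their moduli.\<close>

lemma spectral_radius_bounded_powers:
  fixes P :: "real mat"
  assumes P: "P \<in> carrier_mat n n"
    and sr: "spectral_radius (map_mat complex_of_real P) < 1"
  shows "\<exists>c. \<forall>k i j. i < n \<longrightarrow> j < n \<longrightarrow> \<bar>(P ^\<^sub>m k) $$ (i, j)\<bar> \<le> c"
proof -
  let ?Q = "map_mat complex_of_real P"
  have Q: "?Q \<in> carrier_mat n n" using P by simp
  obtain c where c: "norm_bound (?Q ^\<^sub>m k) c" for k
    using spectral_radius_jnf_norm_bound_less_1_upper_triangular[OF Q sr] by blast
  have "\<bar>(P ^\<^sub>m k) $$ (i, j)\<bar> \<le> c" if "i < n" "j < n" for k i j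
  proof -
    have "?Q ^\<^sub>m k = map_mat complex_of_real (P ^\<^sub>m k)"
      using of_real_hom.mat_hom_pow[OF P] by metis
    moreover have "dim_row (P ^\<^sub>m k) = n" "dim_col (P ^\<^sub>m k) = n"
      using pow_carrier_mat[OF P, of k] by auto
    ultimately show ?thesis
      using c[of k] that unfolding norm_bound_def by simp
  qed
  then show ?thesis by blast
qed

text \<open>If some entry of \<open>x\<close> were negative, the powers of \<open>M\<close> scaled by a number strictly
  between the spectral radius and \<open>m\<close> would be unbounded on \<open>x\<close>.\<close>

lemma nonneg_if_supersolution:
  fixes M :: "real mat"
  assumes M: "M \<in> carrier_mat n n" and nonneg: "\<forall>i<n. \<forall>j<n. 0 \<le> M $$ (i, j)"
    and sr: "spectral_radius (map_mat complex_of_real M) \<le> l" and l: "0 \<le> l" "l < m"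
    and x: "x \<in> carrier_vec n" and super: "\<forall>i<n. (M *\<^sub>v x) $ i \<le> m * x $ i"
    and i: "i < n"
  shows "0 \<le> x $ i"
proof (rule ccontr)
  assume "\<not> 0 \<le> x $ i"
  then have neg: "x $ i < 0" by simp
  obtain d where d: "l < d" "d < m" using dense l(2) by blast
  then have d0: "0 < d" using l by simp
  define P where "P = (1 / d) \<cdot>\<^sub>m M"
  have P: "P \<in> carrier_mat n n" using M by (simp add: P_def)
  have "map_mat complex_of_real P = complex_of_real (1 / d) \<cdot>\<^sub>m map_mat complex_of_real M"
    unfolding P_def by (rule eq_matI) auto
  then have "spectral_radius (map_mat complex_of_real P)
      \<le> 1 / d * spectral_radius (map_mat complex_of_real M)"
    using spectral_radius_smult_le[of "map_mat complex_of_real M" n "1 / d"] M i d0 by simp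
  also have "\<dots> < 1" using sr d d0 by (simp add: field_simps)
  finally obtain c where c: "\<And>k i j. i < n \<Longrightarrow> j < n \<Longrightarrow> \<bar>(P ^\<^sub>m k) $$ (i, j)\<bar> \<le> c"
    using spectral_radius_bounded_powers[OF P] by blast
  define y where "y k = (((*\<^sub>v) P) ^^ k) x" for k
  have y: "y k \<in> carrier_vec n" for k
    using x P by (induction k) (auto simp: y_def)
  have Pnn: "0 \<le> P $$ (i, j)" if "i < n" "j < n" for i j
    using nonneg that M d0 by (simp add: P_def)
  have mv: "(P *\<^sub>v z) $ i = (\<Sum>j<n. P $$ (i, j) * z $ j)"
    if "z \<in> carrier_vec n" "i < n" for z i
    using that P by (simp add: scalar_prod_def atLeast0LessThan)
  have Px: "(P *\<^sub>v x) $ i \<le> (m / d) * x $ i" if "i < n" for i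
  proof -
    have "(P *\<^sub>v x) $ i = (1 / d) * (M *\<^sub>v x) $ i"
      using that M x by (simp add: P_def scalar_prod_def sum_divide_distrib)
    also have "\<dots> \<le> (1 / d) * (m * x $ i)"
      using super that d0 by (intro mult_left_mono) auto
    finally show ?thesis by simp
  qed
  \<comment> \<open>Nonnegativity of \<open>P\<close> preserves componentwise inequalities, so every
    further application of \<open>P\<close> contributes a factor \<open>m / d\<close>, which exceeds
    1. At a negative entry this contradicts the bounded powers.\<close>
  have decay: "y k $ i \<le> (m / d) ^ k * x $ i" if "i < n" for k i
    using that
  proof (induction k arbitrary: i)
    case (Suc k)
    have "y (Suc k) $ i = (\<Sum>j<n. P $$ (i, j) * y k $ j)"
      using mv[OF y Suc.prems] by (simp add: y_def)
    also have "\<dots> \<le> (\<Sum>j<n. P $$ (i, j) * ((m / d) ^ k * x $ j))"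
      using Suc Pnn by (intro sum_mono mult_left_mono) auto
    also have "\<dots> = (m / d) ^ k * (P *\<^sub>v x) $ i"
      unfolding mv[OF x Suc.prems] sum_distrib_left by (intro sum.cong) auto
    also have "\<dots> \<le> (m / d) ^ k * ((m / d) * x $ i)"
      using d d0 Suc.prems by (intro mult_left_mono Px) auto
    finally show ?case by (simp add: mult_ac)
  qed (simp add: y_def)
  define D where "D = (\<Sum>j<n. c * \<bar>x $ j\<bar>)"
  have lower: "- D \<le> y k $ i" for k
  proof -
    have "y k $ i = (\<Sum>j<n. (P ^\<^sub>m k) $$ (i, j) * x $ j)"
      using i P x pow_mat_mult_vec[OF P x, of k] pow_carrier_mat[OF P, of k]
      by (simp add: y_def scalar_prod_def atLeast0LessThan flip: pow_mat_mult_vec[OF P x])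
    then have "\<bar>y k $ i\<bar> \<le> (\<Sum>j<n. \<bar>(P ^\<^sub>m k) $$ (i, j) * x $ j\<bar>)"
      by simp
    also have "\<dots> \<le> D"
      unfolding D_def abs_mult using c i by (intro sum_mono mult_right_mono) auto
    finally show ?thesis by simp
  qed
  have "1 < m / d" using d d0 by simp
  then obtain k where "D / (- x $ i) < (m / d) ^ k"
    using real_arch_pow by blast
  then have "(m / d) ^ k * x $ i < - D"
    using neg by (simp add: field_simps)
  with decay[OF i, of k] lower[of k] show False by simp
qed

lemma shifted_mult_vec_index:
  fixes M :: "real mat"
  assumes M: "M \<in> carrier_mat n n" and v: "v \<in> carrier_vec n" and i: "i < n"
  shows "((m \<cdot>\<^sub>m 1\<^sub>m n - M) *\<^sub>v v) $ i = m * v $ i - (M *\<^sub>v v) $ i"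
proof -
  have "((m \<cdot>\<^sub>m 1\<^sub>m n - M) *\<^sub>v v) $ i
      = (\<Sum>j<n. m * (if j = i then v $ j else 0) - M $$ (i, j) * v $ j)"
    using M v i
    by (simp add: scalar_prod_def atLeast0LessThan left_diff_distrib) (rule sum.cong, auto)
  also have "\<dots> = m * v $ i - (\<Sum>j<n. M $$ (i, j) * v $ j)"
    using i unfolding sum_subtractf sum_distrib_left[symmetric] by (simp add: sum.delta)
  also have "(\<Sum>j<n. M $$ (i, j) * v $ j) = (M *\<^sub>v v) $ i"
    using M v i by (simp add: scalar_prod_def atLeast0LessThan)
  finally show ?thesis .
qed

text \<open>A kernel vector satisfies \<open>M v = m v\<close>, so both \<open>v\<close> and
  \<open>- v\<close> are supersolutions; both are then nonnegative and \<open>v\<close>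
  vanishes.\<close>

lemma det_shifted_nonzero:
  fixes M :: "real mat"
  assumes M: "M \<in> carrier_mat n n" and nonneg: "\<forall>i<n. \<forall>j<n. 0 \<le> M $$ (i, j)"
    and sr: "spectral_radius (map_mat complex_of_real M) \<le> l" and l: "0 \<le> l" "l < m"
  shows "det (m \<cdot>\<^sub>m 1\<^sub>m n - M) \<noteq> 0"
proof
  let ?A = "m \<cdot>\<^sub>m 1\<^sub>m n - M"
  assume "det ?A = 0"
  moreover have A: "?A \<in> carrier_mat n n" using M by (rule minus_carrier_mat)
  ultimately obtain v where v: "v \<in> carrier_vec n" "v \<noteq> 0\<^sub>v n" "?A *\<^sub>v v = 0\<^sub>v n"
    using det_0_iff_vec_prod_zero[OF A] by blast
  have eq: "(M *\<^sub>v v) $ i = m * v $ i" if "i < n" for i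
    using shifted_mult_vec_index[OF M v(1) that, of m] v(3) that by simp
  have "0 \<le> v $ i" if "i < n" for i
    using nonneg_if_supersolution[OF M nonneg sr l v(1) _ that] eq by simp
  moreover have "\<forall>i<n. (M *\<^sub>v (- v)) $ i \<le> m * (- v) $ i"
    using eq v(1) M by (simp add: carrier_matD carrier_vecD scalar_prod_uminus_right)
  then have "0 \<le> (- v) $ i" if "i < n" for i
    using nonneg_if_supersolution[OF M nonneg sr l _ _ that, of "- v"] v(1) by simp
  ultimately have "v $ i = 0" if "i < n" for i
    using that v(1) by force
  then have "v = 0\<^sub>v n"
    using v(1) by (intro eq_vecI) auto
  with v(2) show False by simp
qed

lemma shifted_solvable:
  fixes M :: "real mat"
  assumes M: "M \<in> carrier_mat n n" and nonneg: "\<forall>i<n. \<forall>j<n. 0 \<le> M $$ (i, j)"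
    and sr: "spectral_radius (map_mat complex_of_real M) \<le> l" and l: "0 \<le> l" "l < m"
    and b: "b \<in> carrier_vec n"
  shows "\<exists>x\<in>carrier_vec n. \<forall>i<n. m * x $ i = (M *\<^sub>v x) $ i + b $ i"
proof -
  let ?A = "m \<cdot>\<^sub>m 1\<^sub>m n - M"
  have A: "?A \<in> carrier_mat n n" using M by (rule minus_carrier_mat)
  obtain B where B: "B \<in> carrier_mat n n" "?A * B = 1\<^sub>m n"
    using det_non_zero_imp_unit[OF A det_shifted_nonzero[OF M nonneg sr l]]
    unfolding Units_def ring_mat_def by auto
  have x: "B *\<^sub>v b \<in> carrier_vec n" using B b by simp
  have "?A *\<^sub>v (B *\<^sub>v b) = b"
    using assoc_mult_mat_vec[OF A B(1) b] B(2) b by simp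
  then have "b $ i = m * (B *\<^sub>v b) $ i - (M *\<^sub>v (B *\<^sub>v b)) $ i" if "i < n" for i
    using shifted_mult_vec_index[OF M x that, of m] by simp
  with x show ?thesis by (intro bexI[of _ "B *\<^sub>v b"]) auto
qed


section \<open>Bit sizes\<close>

text \<open>Unlike \<open>bit_size\<close>, this symmetric bound on numerator and denominator, which need not be in
  lowest terms, is additive under both sums and products.\<close>

definition bounded_rat :: "nat \<Rightarrow> real \<Rightarrow> bool" where
  "bounded_rat a x \<longleftrightarrow>
     (\<exists>p q :: int. x = of_int p / of_int q \<and> 0 < q \<and> \<bar>p\<bar> \<le> 2 ^ a \<and> q \<le> 2 ^ a)"

lemma the_of_rat: "(THE r. real_of_rat s = real_of_rat r) = s"
  by (rule the_equality) (simp_all add: of_rat_eq_iff)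

lemma bounded_rat_bit_size:
  assumes "x \<in> \<rat>"
  shows "bounded_rat (bit_size x) x"
proof -
  from assms obtain r where x: "x = real_of_rat r" by (rule Rats_cases)
  obtain p q where pq: "quotient_of r = (p, q)" by force
  have size: "bit_size x = 1 + nat (bitlen \<bar>p\<bar>) + nat (bitlen q)"
    by (simp add: bit_size_def x the_of_rat pq)
  have q: "0 < q" using quotient_of_denom_pos[OF pq] .
  have le: "y \<le> 2 ^ nat (bitlen y)" if "0 \<le> y" for y :: int
    using bitlen_bounds[of y] that by (cases "y = 0") auto
  have "\<bar>p\<bar> \<le> 2 ^ nat (bitlen \<bar>p\<bar>)" "q \<le> 2 ^ nat (bitlen q)" using le q by auto
  moreover have "(2 :: int) ^ nat (bitlen \<bar>p\<bar>) \<le> 2 ^ bit_size x"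
    "(2 :: int) ^ nat (bitlen q) \<le> 2 ^ bit_size x"
    unfolding size by (rule power_increasing; simp)+
  ultimately have "\<bar>p\<bar> \<le> 2 ^ bit_size x" "q \<le> 2 ^ bit_size x" by linarith+
  moreover have "x = of_int p / of_int q"
    unfolding x quotient_of_div[OF pq] by (simp add: of_rat_divide)
  ultimately show ?thesis using q unfolding bounded_rat_def by blast
qed

lemma bounded_rat_mono:
  assumes "bounded_rat a x" "a \<le> b"
  shows "bounded_rat b x"
proof -
  have "(2 :: int) ^ a \<le> 2 ^ b" using assms(2) by (intro power_increasing) auto
  moreover obtain p q where "x = of_int p / of_int q" "0 < q" "\<bar>p\<bar> \<le> 2 ^ a" "q \<le> 2 ^ a"
    using assms(1) unfolding bounded_rat_def by blast
  ultimately show ?thesis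
    unfolding bounded_rat_def by (intro exI[of _ p] exI[of _ q]) linarith
qed

lemma bounded_rat_0: "bounded_rat 0 0"
  unfolding bounded_rat_def by (intro exI[of _ 0] exI[of _ 1]) simp

lemma bounded_rat_1: "bounded_rat 0 1"
  unfolding bounded_rat_def by (intro exI[of _ 1]) simp

lemma bounded_rat_mult:
  assumes "bounded_rat a x" "bounded_rat b y"
  shows "bounded_rat (a + b) (x * y)"
proof -
  obtain p q r s where 1: "x = of_int p / of_int q" "0 < q" "\<bar>p\<bar> \<le> 2 ^ a" "q \<le> 2 ^ a"
    and 2: "y = of_int r / of_int s" "0 < s" "\<bar>r\<bar> \<le> 2 ^ b" "s \<le> 2 ^ b"
    using assms unfolding bounded_rat_def by metis
  have "\<bar>p * r\<bar> \<le> 2 ^ (a + b)" "q * s \<le> 2 ^ (a + b)" "0 < q * s"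
    unfolding abs_mult power_add using 1 2 by (auto intro!: mult_mono)
  moreover have "x * y = of_int (p * r) / of_int (q * s)" using 1 2 by simp
  ultimately show ?thesis unfolding bounded_rat_def by blast
qed

lemma bounded_rat_uminus: "bounded_rat a x \<Longrightarrow> bounded_rat a (- x)"
  unfolding bounded_rat_def by (metis abs_minus_cancel minus_divide_left of_int_minus)

text \<open>The extra bit pays for the sum of the two cross products in the numerator.\<close>

lemma bounded_rat_add:
  assumes "bounded_rat a x" "bounded_rat b y"
  shows "bounded_rat (a + b + 1) (x + y)"
proof -
  obtain p q r s where 1: "x = of_int p / of_int q" "0 < q" "\<bar>p\<bar> \<le> 2 ^ a" "q \<le> 2 ^ a"
    and 2: "y = of_int r / of_int s" "0 < s" "\<bar>r\<bar> \<le> 2 ^ b" "s \<le> 2 ^ b"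
    using assms unfolding bounded_rat_def by metis
  have "\<bar>p * s\<bar> \<le> 2 ^ (a + b)" "\<bar>r * q\<bar> \<le> 2 ^ b * 2 ^ a"
    unfolding abs_mult power_add using 1 2 by (auto intro!: mult_mono)
  then have num: "\<bar>p * s + r * q\<bar> \<le> 2 ^ (a + b + 1)"
    by (simp add: power_add mult.commute abs_triangle_ineq[THEN order_trans])
  have "q * s \<le> 2 ^ (a + b)" unfolding power_add using 1 2 by (auto intro!: mult_mono)
  also have "\<dots> \<le> 2 ^ (a + b + 1)" by simp
  finally have den: "q * s \<le> 2 ^ (a + b + 1)" .
  have "x + y = of_int (p * s + r * q) / of_int (q * s)" using 1 2 by (simp add: field_simps)
  moreover have "0 < q * s" using 1 2 by simp
  ultimately show ?thesis using num den unfolding bounded_rat_def by blast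
qed

lemma bounded_rat_diff:
  "bounded_rat a x \<Longrightarrow> bounded_rat b y \<Longrightarrow> bounded_rat (a + b + 1) (x - y)"
  using bounded_rat_add[of a x b "- y"] bounded_rat_uminus by simp

text \<open>Passing to lowest terms only shrinks: by coprimality the reduced denominator divides
  \<open>q\<close>, and the numerator loses the same factor. A number up to \<open>2 ^ a\<close> has
  at most \<open>a + 1\<close> binary digits, and twice this plus the sign gives
  \<open>2 * a + 3\<close>.\<close>

lemma bit_size_bounded_rat:
  assumes "bounded_rat a x"
  shows "x \<in> \<rat>" "bit_size x \<le> 2 * a + 3"
proof -
  obtain p q where x: "x = of_int p / of_int q" "0 < q" "\<bar>p\<bar> \<le> 2 ^ a" "q \<le> 2 ^ a"
    using assms unfolding bounded_rat_def by metis
  show "x \<in> \<rat>" unfolding x(1) by simp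
  obtain p' q' where pq: "quotient_of (Rat.Fract p q) = (p', q')" by force
  have xr: "x = real_of_rat (Rat.Fract p q)"
    using x by (simp add: Fract_of_int_quotient of_rat_divide)
  have q': "0 < q'" "coprime p' q'" using quotient_of_denom_pos[OF pq] quotient_of_coprime[OF pq] .
  have "p' * q = p * q'"
    using quotient_of_eq[OF pq] q'(1) x(2) by (simp add: eq_rat)
  then have "q' dvd p' * q" by simp
  then have dvd: "q' dvd q" using q'(2) by (simp add: coprime_commute coprime_dvd_mult_right_iff)
  then have leq: "q' \<le> q" using x(2) by (intro zdvd_imp_le)
  obtain k where k: "q = q' * k" using dvd by auto
  then have "p = p' * k" using \<open>p' * q = p * q'\<close> q'(1) by simp
  moreover have "1 \<le> k" using k x(2) q'(1) by (simp add: zero_less_mult_iff)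
  ultimately have lep: "\<bar>p'\<bar> \<le> \<bar>p\<bar>"
    using mult_left_mono[of 1 k "\<bar>p'\<bar>"] by (simp add: abs_mult)
  have len: "bitlen y \<le> int a + 1" if "y \<le> 2 ^ a" for y
  proof -
    have "(0 :: int) < 2 ^ a" by simp
    then have "y < 2 * 2 ^ a" using that by linarith
    then have "y < 2 ^ nat (int a + 1)" by (simp add: nat_add_distrib)
    then show ?thesis by (simp add: bitlen_le_iff_power)
  qed
  have "bitlen \<bar>p'\<bar> \<le> int a + 1" "bitlen q' \<le> int a + 1"
    using lep leq x by (auto intro!: len)
  then show "bit_size x \<le> 2 * a + 3"
    by (simp add: bit_size_def xr the_of_rat pq)
qed

lemma bit_size_le_total_bits: "x \<in> set xs \<Longrightarrow> bit_size x \<le> total_bits xs"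
  by (simp add: total_bits_def member_le_sum_list)

text \<open>The sign alone makes every \<open>bit_size\<close> at least 1.\<close>

lemma length_le_total_bits: "length xs \<le> total_bits xs"
  by (induction xs) (auto simp: total_bits_def bit_size_def split: prod.split)

lemma total_bits_le: "\<forall>x\<in>set xs. bit_size x \<le> b \<Longrightarrow> total_bits xs \<le> length xs * b"
  by (induction xs) (auto simp: total_bits_def)


section \<open>Recorded events\<close>

definition events_satisfy :: "(real \<Rightarrow> bool) \<Rightarrow> 'x comp \<Rightarrow> bool" where
  "events_satisfy Q c \<longleftrightarrow> (\<forall>e\<in>set (events c). \<forall>x\<in>numbers e. Q x)"

lemma events_satisfy_return [simp]: "events_satisfy Q (return x)"
  by (simp add: events_satisfy_def return_def)

lemma events_satisfy_bind [simp]: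
  "events_satisfy Q (bind_comp c k) \<longleftrightarrow> events_satisfy Q c \<and> events_satisfy Q (k (result c))"
  by (auto simp: events_satisfy_def bind_comp_def)

lemma events_satisfy_arith [simp]:
  "events_satisfy Q (arith f x y) \<longleftrightarrow> Q x \<and> Q y \<and> Q (apply_arith f x y)"
  by (auto simp: events_satisfy_def arith_def)

lemma events_satisfy_leq [simp]: "events_satisfy Q (leq x y) \<longleftrightarrow> Q x \<and> Q y"
  by (auto simp: events_satisfy_def leq_def)

lemma events_satisfy_map_comp [simp]:
  "events_satisfy Q (map_comp f xs) \<longleftrightarrow> (\<forall>x\<in>set xs. events_satisfy Q (f x))"
  by (induction xs) auto

lemma events_satisfy_mono:
  "events_satisfy Q c \<Longrightarrow> (\<And>x. Q x \<Longrightarrow> R x) \<Longrightarrow> events_satisfy R c"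
  by (auto simp: events_satisfy_def)

text \<open>Think of \<open>R a\<close> as "of size at most \<open>a\<close>". Each step may raise
  the level by \<open>d\<close>, so sizes grow linearly along the list; a constant \<open>R\<close>
  with \<open>d = 0\<close> gives a plain invariant.\<close>

lemma events_satisfy_fold_comp:
  fixes R :: "nat \<Rightarrow> real \<Rightarrow> bool"
  assumes mono: "\<And>a b x. R a x \<Longrightarrow> a \<le> b \<Longrightarrow> R b x"
    and step: "\<And>a s x. x \<in> set xs \<Longrightarrow> c \<le> a \<Longrightarrow> R a s \<Longrightarrow>
      R (a + d) (result (f s x)) \<and> events_satisfy (R (a + d)) (f s x)"
    and start: "R c s"
  shows "R (c + length xs * d) (result (fold_comp f s xs)) \<and>
    events_satisfy (R (c + length xs * d)) (fold_comp f s xs)"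
  using step start
proof (induction xs arbitrary: s c)
  case (Cons x xs)
  have 1: "R (c + d) (result (f s x))" "events_satisfy (R (c + d)) (f s x)"
    using Cons.prems by auto
  have "R (c + d + length xs * d) (result (fold_comp f (result (f s x)) xs)) \<and>
    events_satisfy (R (c + d + length xs * d)) (fold_comp f (result (f s x)) xs)"
    using Cons.prems(1) 1(1) by (intro Cons.IH) auto
  moreover have "events_satisfy (R (c + d + length xs * d)) (f s x)"
    using 1(2) by (rule events_satisfy_mono) (erule mono, simp)
  ultimately show ?case by (simp add: add_ac)
qed simp

definition cost :: "'x comp \<Rightarrow> nat" where
  "cost c = length (events c)"

lemma cost_return [simp]: "cost (return x) = 0"
  by (simp add: cost_def return_def)

lemma cost_bind [simp]: "cost (bind_comp c k) = cost c + cost (k (result c))"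
  by (simp add: cost_def bind_comp_def)

lemma cost_arith [simp]: "cost (arith f x y) = 1"
  by (simp add: cost_def arith_def)

lemma cost_leq [simp]: "cost (leq x y) = 1"
  by (simp add: cost_def leq_def)

lemma cost_map_comp_le: "\<forall>x\<in>set xs. cost (f x) \<le> b \<Longrightarrow> cost (map_comp f xs) \<le> length xs * b"
  by (induction xs) auto

lemma cost_fold_comp_le:
  "(\<And>s x. x \<in> set xs \<Longrightarrow> cost (f s x) \<le> b) \<Longrightarrow> cost (fold_comp f s xs) \<le> length xs * b"
  by (induction xs arbitrary: s) (auto intro!: add_mono)

lemma cost_extremal_comp_le:
  assumes "\<And>x y. cost (cmp x y) = 1"
  shows "cost (extremal_comp cmp xs) \<le> 2 * length xs"
proof -
  let ?f = "fold_comp (\<lambda>m (x, y). do { c \<leftarrow> cmp y m; return (if c then m else y) })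
      (snd (hd xs)) (tl xs)"
  let ?m = "\<lambda>m. map_comp (\<lambda>(x, y). cmp m y) xs"
  have "cost ?f \<le> length (tl xs) * 1"
    using assms by (intro cost_fold_comp_le) (auto split: prod.split)
  moreover have "cost (?m (result ?f)) \<le> length xs * 1"
    using assms by (intro cost_map_comp_le) auto
  moreover have "cost (extremal_comp cmp xs) = cost ?f + cost (?m (result ?f))"
    unfolding extremal_comp_def cost_bind cost_return by simp
  moreover have "length (tl xs) \<le> length xs" by simp
  ultimately show ?thesis by linarith
qed

lemma events_satisfy_extremal_comp:
  assumes "\<And>x y. Q x \<Longrightarrow> Q y \<Longrightarrow> events_satisfy Q (cmp x y)"
    and "xs \<noteq> []" and "\<forall>x\<in>set xs. Q (snd x)"
  shows "events_satisfy Q (extremal_comp cmp xs)" "Q (fst (result (extremal_comp cmp xs)))"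
proof -
  let ?f = "fold_comp (\<lambda>m (x, y). do { c \<leftarrow> cmp y m; return (if c then m else y) })
      (snd (hd xs)) (tl xs)"
  have "set (tl xs) \<subseteq> set xs" using assms(2) by (meson list.set_sel(2) subsetI)
  then have tl: "\<forall>x\<in>set (tl xs). Q (snd x)" using assms(3) by blast
  \<comment> \<open>Selecting an extremum only compares and copies numbers, so the level never
    rises.\<close>
  have fold: "Q (result ?f) \<and> events_satisfy Q ?f"
    using assms tl
    by (intro events_satisfy_fold_comp[where R = "\<lambda>_. Q" and c = 0 and d = 0])
      (fastforce split: prod.split)+
  then show "events_satisfy Q (extremal_comp cmp xs)"
    using assms(1,3) by (auto simp: extremal_comp_def)
  show "Q (fst (result (extremal_comp cmp xs)))"
    using fold by (simp add: extremal_comp_def)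
qed


section \<open>Cost and bit size of one iteration\<close>

lemma length_triples: "length (triples G) = (\<Sum>i<nstates G. length (acts1 G i) * length (acts2 G i))"
proof -
  have "sum_list (map f [0..<m]) = (\<Sum>i<m. f i)" for f :: "nat \<Rightarrow> nat" and m
    by (induction m) auto
  then show ?thesis
    by (simp add: triples_def length_concat comp_def sum_list_triv)
qed

text \<open>A state contributes the product of its two numbers of actions, and both factors are at
  least 1.\<close>

lemma sum_acts_le_triples:
  assumes "game_instance G"
  shows "(\<Sum>i<nstates G. length (acts1 G i)) \<le> length (triples G)"
    and "(\<Sum>i<nstates G. length (acts2 G i)) \<le> length (triples G)"
  using assms unfolding length_triples game_instance_def
  by (auto intro!: sum_mono simp: Suc_le_eq)

lemma acts_le_triples:
  assumes "game_instance G" "i < nstates G"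
  shows "length (acts1 G i) \<le> length (triples G)" "length (acts2 G i) \<le> length (triples G)"
  using sum_acts_le_triples[OF assms(1)] assms(2)
    member_le_sum[of i "{..<nstates G}" "\<lambda>i. length (acts1 G i)"]
    member_le_sum[of i "{..<nstates G}" "\<lambda>i. length (acts2 G i)"]
  by auto

lemma game_data_mem:
  assumes "i < nstates G" "a \<in> set (acts1 G i)" "b \<in> set (acts2 G i)"
  shows "disc G i a b \<in> set (game_data G)" "pay G i a b \<in> set (game_data G)"
    and "j < nstates G \<Longrightarrow> prob G i a b j \<in> set (game_data G)"
  using assms by (auto simp: game_data_def triples_def intro!: bexI[of _ i] bexI[of _ a] bexI[of _ b])

text \<open>A single triple already contributes \<open>nstates G + 2\<close> data, each of at least
  one bit. This lets bit sizes be bounded in terms of \<open>total_bits\<close> alone.\<close>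

lemma nstates_le_total_bits:
  assumes "game_instance G"
  shows "nstates G \<le> total_bits (game_data G)"
proof -
  have "hd (acts1 G 0) \<in> set (acts1 G 0)" "hd (acts2 G 0) \<in> set (acts2 G 0)"
    using assms by (auto simp: game_instance_def)
  moreover have "0 < nstates G" using assms by (simp add: game_instance_def)
  ultimately have "(0, hd (acts1 G 0), hd (acts2 G 0)) \<in> set (triples G)"
    by (auto simp: triples_def intro!: bexI[of _ 0] bexI[of _ "hd (acts1 G 0)"])
  then have "1 \<le> length (triples G)"
    by (cases "triples G") auto
  moreover have "length (game_data G) = length (triples G) * (nstates G + 2)"
    by (auto simp: game_data_def length_concat comp_def case_prod_beta sum_list_triv)
  ultimately have "nstates G \<le> length (game_data G)"
    using mult_right_mono[of 1 "length (triples G)" "nstates G + 2"] by simp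
  with length_le_total_bits show ?thesis by (rule le_trans[rotated])
qed

lemma cost_payoff_comp_le: "cost (payoff_comp G v i a b) \<le> nstates G * 3"
  unfolding payoff_comp_def
  using cost_fold_comp_le[of "[0..<nstates G]"
      "\<lambda>s j. do { m \<leftarrow> arith Mul (disc G i a b) (prob G i a b j);
        t \<leftarrow> arith Mul m (v $ j); arith Add s t }" 3]
  by simp

lemma cost_response_comp_le:
  assumes G: "game_instance G" "i < nstates G" and N: "N = nstates G + length (triples G)"
  shows "cost (response_comp G v i a) \<le> 3 * N ^ 2 + 2 * N"
proof -
  have len: "length (acts2 G i) \<le> N" and n: "nstates G \<le> N"
    using acts_le_triples[OF G] N by auto
  have "cost (map_comp (payoff_comp G v i a) (acts2 G i)) \<le> length (acts2 G i) * (nstates G * 3)"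
    by (intro cost_map_comp_le ballI cost_payoff_comp_le)
  also have "\<dots> \<le> N * (N * 3)" using len n by (intro mult_mono) auto
  finally have 1: "cost (map_comp (payoff_comp G v i a) (acts2 G i)) \<le> 3 * N ^ 2"
    by (simp add: power2_eq_square)
  have "cost (extremal_comp leq (zip (acts2 G i) ys)) \<le> 2 * N" for ys
    using len by (intro cost_extremal_comp_le[THEN le_trans]) auto
  with 1 show ?thesis unfolding response_comp_def cost_bind by (intro add_mono) auto
qed

lemma cost_eval_policy_comp_le:
  assumes G: "game_instance G" and N: "N = nstates G + length (triples G)"
  shows "cost (eval_policy_comp G \<sigma> v) \<le> N * (3 * N ^ 2 + 2 * N)"
proof -
  have "cost (eval_policy_comp G \<sigma> v) \<le> length [0..<nstates G] * (3 * N ^ 2 + 2 * N)"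
    unfolding eval_policy_comp_def
    using cost_response_comp_le[OF G _ N] by (intro cost_map_comp_le) auto
  also have "\<dots> \<le> N * (3 * N ^ 2 + 2 * N)" using N by (intro mult_right_mono) auto
  finally show ?thesis .
qed

lemma cost_eval_comp_le:
  assumes G: "game_instance G" and N: "N = nstates G + length (triples G)"
  shows "cost (eval_comp G v) \<le> N * (N * (3 * N ^ 2 + 2 * N) + 2 * N)"
proof -
  let ?c = "\<lambda>i. do {
     rs \<leftarrow> map_comp (response_comp G v i) (acts1 G i);
     e \<leftarrow> extremal_comp (\<lambda>x y. leq y x) (zip (acts1 G i) (map fst rs));
     return (rs, e) }"
  have "cost (?c i) \<le> N * (3 * N ^ 2 + 2 * N) + 2 * N" if i: "i < nstates G" for i
  proof -
    have len: "length (acts1 G i) \<le> N" using acts_le_triples[OF G i] N by auto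
    have "cost (map_comp (response_comp G v i) (acts1 G i)) \<le> length (acts1 G i) * (3 * N ^ 2 + 2 * N)"
      by (intro cost_map_comp_le ballI cost_response_comp_le[OF G i N])
    also have "\<dots> \<le> N * (3 * N ^ 2 + 2 * N)" using len by (intro mult_right_mono) auto
    finally have 1: "cost (map_comp (response_comp G v i) (acts1 G i)) \<le> N * (3 * N ^ 2 + 2 * N)" .
    have "cost (extremal_comp (\<lambda>x y. leq y x) (zip (acts1 G i) ys)) \<le> 2 * N" for ys
      using len by (intro cost_extremal_comp_le[THEN le_trans]) auto
    with 1 show ?thesis unfolding cost_bind cost_return by (simp add: add_mono)
  qed
  then have "cost (eval_comp G v) \<le> length [0..<nstates G] * (N * (3 * N ^ 2 + 2 * N) + 2 * N)"
    unfolding eval_comp_def by (intro cost_map_comp_le) auto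
  also have "\<dots> \<le> N * (N * (3 * N ^ 2 + 2 * N) + 2 * N)" using N by (intro mult_right_mono) auto
  finally show ?thesis .
qed

lemma events_satisfy_response_comp:
  assumes "acts2 G i \<noteq> []"
    and "\<forall>b\<in>set (acts2 G i). events_satisfy Q (payoff_comp G v i a b) \<and> Q (payoff G v i a b)"
  shows "events_satisfy Q (response_comp G v i a)" "Q (fst (result (response_comp G v i a)))"
proof -
  let ?xs = "zip (acts2 G i) (map (payoff G v i a) (acts2 G i))"
  have xs: "?xs \<noteq> []" "\<forall>x\<in>set ?xs. Q (snd x)"
    using assms by (auto simp: zip_eq_Nil_iff dest!: set_zip_rightD)
  have ext: "events_satisfy Q (extremal_comp leq ?xs)" "Q (fst (result (extremal_comp leq ?xs)))"
    by (rule events_satisfy_extremal_comp(1)[OF _ xs], simp)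
      (rule events_satisfy_extremal_comp(2)[OF _ xs], simp)
  show "events_satisfy Q (response_comp G v i a)"
    using ext(1) assms(2) by (simp add: response_comp_def)
  show "Q (fst (result (response_comp G v i a)))"
    using ext(2) by (simp add: response_comp_def)
qed

lemma events_satisfy_eval_policy_comp:
  assumes G: "game_instance G" and \<sigma>: "\<sigma> \<in> policies1 G"
    and Q: "\<And>i a b. i < nstates G \<Longrightarrow> a \<in> set (acts1 G i) \<Longrightarrow> b \<in> set (acts2 G i) \<Longrightarrow>
      events_satisfy Q (payoff_comp G v i a b) \<and> Q (payoff G v i a b)"
  shows "events_satisfy Q (eval_policy_comp G \<sigma> v)"
proof -
  have "events_satisfy Q (response_comp G v i (\<sigma> i))" if i: "i < nstates G" for i
  proof -
    have "\<sigma> i \<in> set (acts1 G i)" using \<sigma> i by (auto simp: policies1_def)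
    then show ?thesis
      using events_satisfy_response_comp(1)[of G i Q v "\<sigma> i"] Q[OF i] G i
      by (simp add: game_instance_def)
  qed
  then show ?thesis by (simp add: eval_policy_comp_def)
qed

lemma events_satisfy_eval_comp:
  assumes G: "game_instance G"
    and Q: "\<And>i a b. i < nstates G \<Longrightarrow> a \<in> set (acts1 G i) \<Longrightarrow> b \<in> set (acts2 G i) \<Longrightarrow>
      events_satisfy Q (payoff_comp G v i a b) \<and> Q (payoff G v i a b)"
  shows "events_satisfy Q (eval_comp G v)"
proof -
  have "events_satisfy Q (extremal_comp (\<lambda>x y. leq y x)
      (zip (acts1 G i) (map fst (map (\<lambda>a. result (response_comp G v i a)) (acts1 G i)))))"
    (is "events_satisfy Q (extremal_comp _ ?xs)")
    if i: "i < nstates G" for i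
  proof -
    have ne: "acts1 G i \<noteq> []" "acts2 G i \<noteq> []" using G i by (auto simp: game_instance_def)
    have "Q (fst (result (response_comp G v i a)))" if "a \<in> set (acts1 G i)" for a
      using events_satisfy_response_comp(2)[OF ne(2)] Q[OF i that] by blast
    then have "\<forall>x\<in>set ?xs. Q (snd x)"
      by (auto dest!: set_zip_rightD)
    then show ?thesis
      using ne by (intro events_satisfy_extremal_comp(1)) (auto simp: zip_eq_Nil_iff)
  qed
  moreover have "events_satisfy Q (response_comp G v i a)"
    if "i < nstates G" "a \<in> set (acts1 G i)" for i a
    using events_satisfy_response_comp(1)[of G i Q v a] Q that G by (simp add: game_instance_def)
  ultimately show ?thesis by (simp add: eval_comp_def)
qed

text \<open>Each state adds a product of discount, probability and value, of size
  \<open>2 * T + V\<close>, and one more bit for the addition; the running sum starts from the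
  payment, of size \<open>T\<close>.\<close>

lemma bounded_rat_payoff_comp:
  fixes T V :: nat
  assumes "bounded_rat T (disc G i a b)" "bounded_rat T (pay G i a b)"
    and "\<And>j. j < nstates G \<Longrightarrow> bounded_rat T (prob G i a b j)"
    and "\<And>j. j < nstates G \<Longrightarrow> bounded_rat V (v $ j)"
    and B: "T + nstates G * (2 * T + V + 1) \<le> B"
  shows "events_satisfy (bounded_rat B) (payoff_comp G v i a b) \<and> bounded_rat B (payoff G v i a b)"
proof -
  let ?f = "\<lambda>s j. do { m \<leftarrow> arith Mul (disc G i a b) (prob G i a b j);
    t \<leftarrow> arith Mul m (v $ j); arith Add s t }"
  let ?d = "2 * T + V + 1"
  have "bounded_rat (T + length [0..<nstates G] * ?d) (result (payoff_comp G v i a b)) \<and>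
    events_satisfy (bounded_rat (T + length [0..<nstates G] * ?d)) (payoff_comp G v i a b)"
    unfolding payoff_comp_def
  proof (rule events_satisfy_fold_comp)
    fix c s j assume j: "j \<in> set [0..<nstates G]" and c: "T \<le> c" and s: "bounded_rat c s"
    have m: "bounded_rat (T + T) (disc G i a b * prob G i a b j)"
      using assms j by (intro bounded_rat_mult) auto
    have t: "bounded_rat (T + T + V) (disc G i a b * prob G i a b j * v $ j)"
      using assms j m by (intro bounded_rat_mult) auto
    have "bounded_rat (c + (T + T + V) + 1) (s + disc G i a b * prob G i a b j * v $ j)"
      by (intro bounded_rat_add s t)
    moreover have "c + (T + T + V) + 1 = c + ?d" by simp
    ultimately have r: "bounded_rat (c + ?d) (s + disc G i a b * prob G i a b j * v $ j)"
      by (simp only:)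
    have "bounded_rat (c + ?d) x" if "bounded_rat T x \<or> bounded_rat (T + T) x \<or> bounded_rat V x \<or>
      bounded_rat (T + T + V) x \<or> bounded_rat c x" for x
      using that by (elim disjE) (erule bounded_rat_mono, simp)+
    then show "bounded_rat (c + ?d) (result (?f s j)) \<and> events_satisfy (bounded_rat (c + ?d)) (?f s j)"
      using r m t s assms j by simp
  qed (use assms bounded_rat_mono in auto)
  then have "bounded_rat (T + nstates G * ?d) (payoff G v i a b)"
    "events_satisfy (bounded_rat (T + nstates G * ?d)) (payoff_comp G v i a b)" by simp_all
  then show ?thesis
    using B by (blast intro: bounded_rat_mono events_satisfy_mono)
qed

definition system_mat :: "('a, 'b) game \<Rightarrow> (nat \<Rightarrow> 'a) \<Rightarrow> (nat \<times> 'a \<Rightarrow> 'b) \<Rightarrow> real mat" where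
  "system_mat G \<sigma> \<delta> = 1\<^sub>m (nstates G) - trans_mat G \<sigma> \<delta>"

lemma trans_mat_carrier: "trans_mat G \<sigma> \<delta> \<in> carrier_mat (nstates G) (nstates G)"
  by (simp add: trans_mat_def)

lemma pay_vec_carrier: "pay_vec G \<sigma> \<delta> \<in> carrier_vec (nstates G)"
  by (simp add: pay_vec_def)

lemma system_mat_carrier: "system_mat G \<sigma> \<delta> \<in> carrier_mat (nstates G) (nstates G)"
  unfolding system_mat_def by (rule minus_carrier_mat[OF trans_mat_carrier])

lemma mat_entries_eq:
  assumes "A \<in> carrier_mat n m"
  shows "mat_entries A = concat (map (\<lambda>i. map (\<lambda>j. A $$ (i, j)) [0..<m]) [0..<n])"
  using assms by (auto simp: mat_entries_def rows_def list_of_vec_map intro!: arg_cong[where f = concat])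

lemma mat_entries_system_mat:
  "mat_entries (system_mat G \<sigma> \<delta>) = concat (map (\<lambda>i. map (\<lambda>j.
     (if i = j then 1 else 0) - disc G i (\<sigma> i) (\<delta> (i, \<sigma> i)) * prob G i (\<sigma> i) (\<delta> (i, \<sigma> i)) j)
     [0..<nstates G]) [0..<nstates G])"
  unfolding mat_entries_eq[OF system_mat_carrier]
  by (intro arg_cong[where f = concat] map_cong) (auto simp: system_mat_def trans_mat_def)

lemma list_of_vec_pay_vec:
  "list_of_vec (pay_vec G \<sigma> \<delta>) = map (\<lambda>i. pay G i (\<sigma> i) (\<delta> (i, \<sigma> i))) [0..<nstates G]"
  by (auto simp: pay_vec_def list_of_vec_map)

abbreviation solve_policies ::
    "solver \<Rightarrow> ('a, 'b) game \<Rightarrow> (nat \<Rightarrow> 'a) \<Rightarrow> (nat \<times> 'a \<Rightarrow> 'b) \<Rightarrow> real list comp" where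
  "solve_policies S G \<sigma> \<delta> \<equiv>
     solve S (nstates G) (mat_entries (system_mat G \<sigma> \<delta>)) (list_of_vec (pay_vec G \<sigma> \<delta>))"

lemma result_fixpoint_comp:
  "result (fixpoint_comp S G \<sigma> \<delta>) = vec_of_list (result (solve_policies S G \<sigma> \<delta>))"
  by (simp add: fixpoint_comp_def Let_def mat_entries_system_mat list_of_vec_pay_vec)

lemma cost_fixpoint_comp_le:
  "cost (fixpoint_comp S G \<sigma> \<delta>) \<le> 2 * nstates G ^ 2 + cost (solve_policies S G \<sigma> \<delta>)"
proof -
  let ?n = "nstates G"
  let ?c = "\<lambda>i j. do {
    m \<leftarrow> arith Mul (disc G i (\<sigma> i) (\<delta> (i, \<sigma> i))) (prob G i (\<sigma> i) (\<delta> (i, \<sigma> i)) j);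
    arith Sub (if i = j then 1 else 0) m }"
  have "cost (map_comp (?c i) [0..<?n]) \<le> length [0..<?n] * 2" for i
    by (intro cost_map_comp_le) simp
  then have "cost (map_comp (\<lambda>i. map_comp (?c i) [0..<?n]) [0..<?n])
      \<le> length [0..<?n] * (length [0..<?n] * 2)"
    by (intro cost_map_comp_le) simp
  then show ?thesis
    by (simp add: fixpoint_comp_def Let_def mat_entries_system_mat list_of_vec_pay_vec power2_eq_square)
qed

lemma events_satisfy_fixpoint_comp:
  assumes "\<And>i j. i < nstates G \<Longrightarrow> j < nstates G \<Longrightarrow>
      Q (disc G i (\<sigma> i) (\<delta> (i, \<sigma> i))) \<and> Q (prob G i (\<sigma> i) (\<delta> (i, \<sigma> i)) j) \<and>
      Q (disc G i (\<sigma> i) (\<delta> (i, \<sigma> i)) * prob G i (\<sigma> i) (\<delta> (i, \<sigma> i)) j) \<and>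
      Q (system_mat G \<sigma> \<delta> $$ (i, j))"
    and "Q 0" "Q 1"
    and "events_satisfy Q (solve_policies S G \<sigma> \<delta>)"
  shows "events_satisfy Q (fixpoint_comp S G \<sigma> \<delta>)"
proof -
  have "Q ((if i = j then 1 else 0) -
      disc G i (\<sigma> i) (\<delta> (i, \<sigma> i)) * prob G i (\<sigma> i) (\<delta> (i, \<sigma> i)) j)"
    if "i < nstates G" "j < nstates G" for i j
    using assms(1)[OF that] that by (simp add: system_mat_def trans_mat_def)
  then show ?thesis
    using assms
    by (simp add: fixpoint_comp_def Let_def mat_entries_system_mat list_of_vec_pay_vec)
qed


section \<open>Games with uniformly bounded spectral radius\<close>

locale bounded_game =
  fixes G :: "('a, 'b) game" and lam :: real
  assumes G: "game_instance G" and lam: "0 \<le> lam" "lam < 1"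
    and radius: "\<And>\<sigma> \<delta>. \<sigma> \<in> policies1 G \<Longrightarrow> \<delta> \<in> policies2 G \<Longrightarrow>
      spectral_radius (map_mat complex_of_real (trans_mat G \<sigma> \<delta>)) \<le> lam"
begin

abbreviation n :: nat where "n \<equiv> nstates G"

text \<open>The gap above \<open>lam\<close> makes \<open>\<mu> I - M\<close> invertible for every
  pair of policies, and positivity permits division by \<open>\<mu>\<close> even for
  \<open>lam = 0\<close>.\<close>

definition \<mu> :: real where "\<mu> = (1 + lam) / 2"

lemma \<mu>: "0 < \<mu>" "\<mu> < 1" "lam < \<mu>" "0 \<le> \<mu>"
  using lam by (simp_all add: \<mu>_def)

lemma policy1_mem: "\<sigma> \<in> policies1 G \<Longrightarrow> i < n \<Longrightarrow> \<sigma> i \<in> set (acts1 G i)"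
  by (auto simp: policies1_def)

lemma policy2_mem: "\<delta> \<in> policies2 G \<Longrightarrow> i < n \<Longrightarrow> \<delta> (i, a) \<in> set (acts2 G i)"
  using PiE_mem[of \<delta> "{..<n} \<times> UNIV" "\<lambda>(i, a). set (acts2 G i)" "(i, a)"]
  by (simp add: policies2_def)

lemma acts_nonempty: "i < n \<Longrightarrow> acts1 G i \<noteq> []" "i < n \<Longrightarrow> acts2 G i \<noteq> []"
  using G by (auto simp: game_instance_def)

lemma policy1_exists:
  assumes "\<And>i. i < n \<Longrightarrow> f i \<in> set (acts1 G i)"
  shows "\<exists>\<sigma>\<in>policies1 G. \<forall>i<n. \<sigma> i = f i"
  using assms unfolding policies1_def by (intro bexI[of _ "restrict f {..<n}"]) auto

lemma policy2_exists:
  assumes "\<And>i a. i < n \<Longrightarrow> f i a \<in> set (acts2 G i)"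
  shows "\<exists>\<delta>\<in>policies2 G. \<forall>i<n. \<forall>a. \<delta> (i, a) = f i a"
proof (intro bexI)
  let ?d = "restrict (\<lambda>(i, a). f i a) ({..<n} \<times> UNIV)"
  show "\<forall>i<n. \<forall>a. ?d (i, a) = f i a" by simp
  show "?d \<in> policies2 G" unfolding policies2_def using assms by (intro PiE_I) (auto simp: restrict_def)
qed

definition coeff :: "nat \<Rightarrow> 'a \<Rightarrow> 'b \<Rightarrow> nat \<Rightarrow> real" where
  "coeff i a b j = disc G i a b * prob G i a b j"

lemma coeff_nonneg:
  "i < n \<Longrightarrow> a \<in> set (acts1 G i) \<Longrightarrow> b \<in> set (acts2 G i) \<Longrightarrow> j < n \<Longrightarrow> 0 \<le> coeff i a b j"
  using G by (simp add: game_instance_def coeff_def)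

lemma payoff_coeff: "payoff G v i a b = (\<Sum>j<n. coeff i a b j * v $ j) + pay G i a b"
  by (simp add: payoff_def coeff_def)

lemma trans_mat_index: "i < n \<Longrightarrow> j < n \<Longrightarrow> trans_mat G \<sigma> \<delta> $$ (i, j) = coeff i (\<sigma> i) (\<delta> (i, \<sigma> i)) j"
  by (simp add: trans_mat_def coeff_def)

lemma trans_mat_nonneg:
  assumes "\<sigma> \<in> policies1 G" "\<delta> \<in> policies2 G"
  shows "\<forall>i<n. \<forall>j<n. 0 \<le> trans_mat G \<sigma> \<delta> $$ (i, j)"
  using coeff_nonneg policy1_mem policy2_mem assms by (simp add: trans_mat_index)

lemma trans_mat_mult:
  assumes "v \<in> carrier_vec n" "i < n"
  shows "(trans_mat G \<sigma> \<delta> *\<^sub>v v) $ i = (\<Sum>j<n. coeff i (\<sigma> i) (\<delta> (i, \<sigma> i)) j * v $ j)"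
  using assms trans_mat_carrier[of G \<sigma> \<delta>]
  by (simp add: scalar_prod_def trans_mat_index atLeast0LessThan)

text \<open>Lets a single decision maker choose both actions in each state without leaving the scope
  of \<open>radius\<close>.\<close>

lemma joint_policy_exists:
  assumes "\<And>i. i < n \<Longrightarrow> p i \<in> set (acts1 G i) \<times> set (acts2 G i)"
  obtains \<sigma> \<delta> where "\<sigma> \<in> policies1 G" "\<delta> \<in> policies2 G"
    "\<And>i. i < n \<Longrightarrow> \<sigma> i = fst (p i) \<and> \<delta> (i, fst (p i)) = snd (p i)"
proof -
  obtain \<sigma> where \<sigma>: "\<sigma> \<in> policies1 G" "\<forall>i<n. \<sigma> i = fst (p i)"
    using policy1_exists[of "\<lambda>i. fst (p i)"] assms by (metis mem_Times_iff)
  obtain \<delta> where "\<delta> \<in> policies2 G" "\<forall>i<n. \<forall>a. \<delta> (i, a) = snd (p i)"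
    using policy2_exists[of "\<lambda>i a. snd (p i)"] assms by (metis mem_Times_iff)
  with \<sigma> that show ?thesis by blast
qed

text \<open>The weights are the optimal value of the auxiliary problem \<open>\<mu> u = max M u + 1\<close>, in which one
  player controls both actions.\<close>

lemma weights_exist:
  "\<exists>u. \<forall>i<n. 0 < u i \<and> (\<forall>a\<in>set (acts1 G i). \<forall>b\<in>set (acts2 G i).
     (\<Sum>j<n. coeff i a b j * u j) \<le> \<mu> * u i)"
proof -
  define C where "C i = set (acts1 G i) \<times> set (acts2 G i)" for i
  \<comment> \<open>\<open>optimal_policy_value\<close> minimizes, so the unknown is
    \<open>z = - u\<close>: the equation \<open>\<mu> z = min (M z - 1)\<close> is divided by
    \<open>\<mu>\<close> to become a fixed point equation.\<close>
  define g where "g i c x = ((\<Sum>j<n. coeff i (fst c) (snd c) j * x j) - 1) / \<mu>" for i c x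
  have scaled: "\<mu> * g i c x = (\<Sum>j<n. coeff i (fst c) (snd c) j * x j) - 1" for i c x
    using \<mu>(1) by (simp add: g_def)
  have C: "finite (C i)" "i < n \<Longrightarrow> C i \<noteq> {}" for i using acts_nonempty by (auto simp: C_def)
  have "\<exists>z. \<forall>i<n. Min ((\<lambda>c. g i c z) ` C i) = z i"
  proof (rule optimal_policy_value)
    fix p assume p: "p \<in> PiE {..<n} C"
    then obtain \<sigma> \<delta> where \<sigma>\<delta>: "\<sigma> \<in> policies1 G" "\<delta> \<in> policies2 G"
      "\<And>i. i < n \<Longrightarrow> \<sigma> i = fst (p i) \<and> \<delta> (i, fst (p i)) = snd (p i)"
      by (rule_tac joint_policy_exists[of p]) (auto simp: C_def PiE_iff)
    note M = trans_mat_carrier[of G \<sigma> \<delta>] trans_mat_nonneg[OF \<sigma>\<delta>(1,2)] radius[OF \<sigma>\<delta>(1,2)] lam(1) \<mu>(3)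
    have mult: "(trans_mat G \<sigma> \<delta> *\<^sub>v v) $ i = (\<Sum>j<n. coeff i (fst (p i)) (snd (p i)) j * v $ j)"
      if "v \<in> carrier_vec n" "i < n" for v i
      using trans_mat_mult[OF that] \<sigma>\<delta>(3) that(2) by simp
    show "\<exists>v. \<forall>i<n. g i (p i) v = v i"
    proof -
      obtain x where x: "x \<in> carrier_vec n"
        and eq: "\<forall>i<n. \<mu> * x $ i = (trans_mat G \<sigma> \<delta> *\<^sub>v x) $ i + vec n (\<lambda>i. - 1) $ i"
        using shifted_solvable[OF M, of "vec n (\<lambda>i. - 1)"] by auto
      then have "\<forall>i<n. g i (p i) (\<lambda>i. x $ i) = x $ i"
        using \<mu>(1) by (simp add: g_def mult field_simps)
      then show ?thesis by blast
    qed
    fix v x i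
    assume v: "\<forall>i<n. g i (p i) v = v i" and x: "\<forall>i<n. g i (p i) x \<le> x i" and i: "i < n"
    let ?y = "vec n (\<lambda>i. x i - v i)"
    \<comment> \<open>In the difference of a supersolution and the solution the constant 1 cancels,
      so \<open>nonneg_if_supersolution\<close> serves as the comparison principle.\<close>
    have "\<forall>i<n. (trans_mat G \<sigma> \<delta> *\<^sub>v ?y) $ i \<le> \<mu> * ?y $ i"
    proof (intro allI impI)
      fix i assume i: "i < n"
      have "(trans_mat G \<sigma> \<delta> *\<^sub>v ?y) $ i = (\<Sum>j<n. coeff i (fst (p i)) (snd (p i)) j * (x j - v j))"
        using mult[of ?y i] i by simp
      also have "\<dots> = \<mu> * g i (p i) x - \<mu> * g i (p i) v"
        by (simp add: scaled right_diff_distrib sum_subtractf)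
      also have "\<dots> \<le> \<mu> * x i - \<mu> * v i"
        using v x i \<mu>(1) by simp
      finally show "(trans_mat G \<sigma> \<delta> *\<^sub>v ?y) $ i \<le> \<mu> * ?y $ i"
        using i by (simp add: right_diff_distrib)
    qed
    then have "0 \<le> ?y $ i" using nonneg_if_supersolution[OF M _ _ i, of ?y] by simp
    then show "v i \<le> x i" using i by simp
  qed (use C in \<open>auto simp: g_def\<close>)
  then obtain z where z: "\<And>i. i < n \<Longrightarrow> Min ((\<lambda>c. g i c z) ` C i) = z i" by blast
  define u where "u i = - z i" for i
  have bound: "(\<Sum>j<n. coeff i a b j * u j) + 1 \<le> \<mu> * u i"
    if "i < n" "a \<in> set (acts1 G i)" "b \<in> set (acts2 G i)" for i a b
  proof -
    have "z i \<le> g i (a, b) z"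
      using that C unfolding z[OF that(1), symmetric] by (intro Min_le) (auto simp: C_def)
    then show ?thesis using \<mu>(1) by (simp add: g_def u_def sum_negf field_simps)
  qed
  \<comment> \<open>By \<open>bound\<close>, \<open>u\<close> is a supersolution for any one pair of
    policies; the first listed actions provide one.\<close>
  have "u i \<ge> 0" if "i < n" for i
  proof -
    obtain \<sigma> \<delta> where \<sigma>\<delta>: "\<sigma> \<in> policies1 G" "\<delta> \<in> policies2 G"
      using acts_nonempty
      by (rule_tac joint_policy_exists[of "\<lambda>i. (hd (acts1 G i), hd (acts2 G i))"]) auto
    have "\<forall>i<n. (trans_mat G \<sigma> \<delta> *\<^sub>v vec n u) $ i \<le> \<mu> * vec n u $ i"
    proof (intro allI impI)
      fix i assume i: "i < n"
      show "(trans_mat G \<sigma> \<delta> *\<^sub>v vec n u) $ i \<le> \<mu> * vec n u $ i"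
        using bound[OF i policy1_mem[OF \<sigma>\<delta>(1) i] policy2_mem[OF \<sigma>\<delta>(2) i, of "\<sigma> i"]]
          trans_mat_mult[of "vec n u" i \<sigma> \<delta>] i by simp
    qed
    then have "0 \<le> vec n u $ i"
      using nonneg_if_supersolution[OF trans_mat_carrier trans_mat_nonneg[OF \<sigma>\<delta>]
          radius[OF \<sigma>\<delta>] lam(1) \<mu>(3) _ _ that, of "vec n u"]
      by simp
    then show ?thesis using that by simp
  qed note u0 = this
  \<comment> \<open>The constant 1 in \<open>bound\<close> makes the sign strict.\<close>
  have "0 < u i" if i: "i < n" for i
  proof -
    have m: "hd (acts1 G i) \<in> set (acts1 G i)" "hd (acts2 G i) \<in> set (acts2 G i)"
      using acts_nonempty[OF i] by auto
    have "0 \<le> (\<Sum>j<n. coeff i (hd (acts1 G i)) (hd (acts2 G i)) j * u j)"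
      using coeff_nonneg[OF i m] u0 by (intro sum_nonneg mult_nonneg_nonneg) auto
    with bound[OF i m] have "0 < \<mu> * u i" by linarith
    then show ?thesis using \<mu>(1) by (simp add: zero_less_mult_iff)
  qed
  moreover have "(\<Sum>j<n. coeff i a b j * u j) \<le> \<mu> * u i"
    if "i < n" "a \<in> set (acts1 G i)" "b \<in> set (acts2 G i)" for i a b
    using bound[OF that] by simp
  ultimately show ?thesis by blast
qed

definition u :: "nat \<Rightarrow> real" where
  "u = (SOME u. \<forall>i<n. 0 < u i \<and> (\<forall>a\<in>set (acts1 G i). \<forall>b\<in>set (acts2 G i).
     (\<Sum>j<n. coeff i a b j * u j) \<le> \<mu> * u i))"

lemma u:
  "i < n \<Longrightarrow> 0 < u i"
  "i < n \<Longrightarrow> a \<in> set (acts1 G i) \<Longrightarrow> b \<in> set (acts2 G i) \<Longrightarrow> (\<Sum>j<n. coeff i a b j * u j) \<le> \<mu> * u i"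
  using someI_ex[OF weights_exist, folded u_def] by blast+

section \<open>The operators of both players as contracting games with the same weights\<close>

lemma payoff_step:
  assumes "i < n" "a \<in> set (acts1 G i)" "b \<in> set (acts2 G i)" "0 \<le> t"
    and le: "\<forall>j<n. v j \<le> w j + t * u j"
  shows "payoff G (vec n v) i a b \<le> payoff G (vec n w) i a b + \<mu> * t * u i"
proof -
  have "(\<Sum>j<n. coeff i a b j * v j) \<le> (\<Sum>j<n. coeff i a b j * (w j + t * u j))"
    using le coeff_nonneg[OF assms(1-3)] by (intro sum_mono mult_left_mono) auto
  also have "\<dots> = (\<Sum>j<n. coeff i a b j * w j) + t * (\<Sum>j<n. coeff i a b j * u j)"
    by (simp add: distrib_left sum.distrib sum_distrib_left mult.left_commute)
  also have "t * (\<Sum>j<n. coeff i a b j * u j) \<le> t * (\<mu> * u i)"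
    using u(2)[OF assms(1-3)] assms(4) by (intro mult_left_mono)
  finally show ?thesis by (simp add: payoff_coeff mult_ac)
qed

text \<open>Answering each action by its best response turns the outer iteration into a one-player
  problem, whose policy operators are the nonlinear maps \<open>f_policy G \<sigma>\<close>.\<close>

definition outer_op :: "nat \<Rightarrow> 'a \<Rightarrow> (nat \<Rightarrow> real) \<Rightarrow> real" where
  "outer_op i a x = Max ((\<lambda>b. payoff G (vec n x) i a b) ` set (acts2 G i))"

text \<open>The changes of sign turn the maximization of the second player into the minimization of
  \<open>contracting_game\<close>.\<close>

definition inner_op :: "(nat \<Rightarrow> 'a) \<Rightarrow> nat \<Rightarrow> 'b \<Rightarrow> (nat \<Rightarrow> real) \<Rightarrow> real" where
  "inner_op \<sigma> i b x = - payoff G (vec n (\<lambda>j. - x j)) i (\<sigma> i) b"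

lemma inner_contracting:
  assumes "\<sigma> \<in> policies1 G"
  shows "contracting_game n (\<lambda>i. set (acts2 G i)) (inner_op \<sigma>) u \<mu>"
proof
  fix i b v w and t :: real
  assume *: "i < n" "b \<in> set (acts2 G i)" "0 \<le> t" "\<forall>j<n. v j \<le> w j + t * u j"
  \<comment> \<open>Negation exchanges the roles of \<open>v\<close> and \<open>w\<close> in the
    hypothesis and exchanges them back in the conclusion.\<close>
  have "\<forall>j<n. - w j \<le> - v j + t * u j" using *(4) by auto
  from payoff_step[OF *(1) policy1_mem[OF assms *(1)] *(2,3) this]
  show "inner_op \<sigma> i b v \<le> inner_op \<sigma> i b w + \<mu> * t * u i"
    by (simp add: inner_op_def)
qed (use acts_nonempty u \<mu> in auto)

lemma outer_contracting: "contracting_game n (\<lambda>i. set (acts1 G i)) outer_op u \<mu>"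
proof
  fix i a v w and t :: real
  assume *: "i < n" "a \<in> set (acts1 G i)" "0 \<le> t" "\<forall>j<n. v j \<le> w j + t * u j"
  have "payoff G (vec n v) i a b \<le> outer_op i a w + \<mu> * t * u i" if "b \<in> set (acts2 G i)" for b
  proof -
    have "payoff G (vec n w) i a b \<le> outer_op i a w"
      unfolding outer_op_def using that by (intro Max_ge) auto
    with payoff_step[OF *(1,2) that *(3,4)] show ?thesis by simp
  qed
  then show "outer_op i a v \<le> outer_op i a w + \<mu> * t * u i"
    unfolding outer_op_def[of i a v] using acts_nonempty(2)[OF *(1)] by (intro Max.boundedI) auto
qed (use acts_nonempty u \<mu> in auto)

lemma vec_index_vec: "v \<in> carrier_vec n \<Longrightarrow> vec n (($) v) = v"
  by auto

lemma f_policy_carrier [simp]: "f_policy G \<sigma> v \<in> carrier_vec n"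
  by (simp add: f_policy_def)

lemma f_op_carrier [simp]: "f_op G v \<in> carrier_vec n"
  by (simp add: f_op_def)

lemma f_policies_carrier [simp]: "f_policies G \<sigma> \<delta> v \<in> carrier_vec n"
  unfolding f_policies_def by (intro carrier_vecI) (simp add: pay_vec_def)

lemma vec_eq_index:
  assumes "v \<in> carrier_vec n" "w \<in> carrier_vec n"
  shows "v = w \<longleftrightarrow> (\<forall>i<n. v $ i = w $ i)"
  using assms by (auto simp: vec_eq_iff)

lemma outer_op_index:
  assumes "v \<in> carrier_vec n" "i < n"
  shows "outer_op i (\<sigma> i) (($) v) = f_policy G \<sigma> v $ i"
  using assms by (simp add: outer_op_def f_policy_index[OF G] vec_index_vec)

lemma outer_F_index:
  assumes "v \<in> carrier_vec n" "i < n"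
  shows "contracting_game.F (\<lambda>i. set (acts1 G i)) outer_op (($) v) i = f_op G v $ i"
  using assms
  by (simp add: contracting_game.F_def[OF outer_contracting] outer_op_def f_op_def vec_index_vec)

lemma inner_op_index:
  assumes "v \<in> carrier_vec n" "i < n"
  shows "inner_op \<sigma> i (\<delta> (i, \<sigma> i)) (\<lambda>j. - v $ j) = - f_policies G \<sigma> \<delta> v $ i"
  using assms by (simp add: inner_op_def f_policies_index vec_index_vec)

lemma inner_F_index:
  assumes "\<sigma> \<in> policies1 G" "v \<in> carrier_vec n" "i < n"
  shows "contracting_game.F (\<lambda>i. set (acts2 G i)) (inner_op \<sigma>) (\<lambda>j. - v $ j) i = - f_policy G \<sigma> v $ i"
proof -
  have "Min (uminus ` A) = - Max A" if "finite A" "A \<noteq> {}" for A :: "real set"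
    using that by (intro Min_eqI) auto
  from this[of "(\<lambda>b. payoff G v i (\<sigma> i) b) ` set (acts2 G i)"] show ?thesis
    using assms acts_nonempty(2)[OF assms(3)]
    by (simp add: contracting_game.F_def[OF inner_contracting] inner_op_def image_image
        f_policy_index[OF G] vec_index_vec)
qed

section \<open>Fixed points for pairs of policies, for one fixed policy, and for the game\<close>

lemma f_policies_fixpoint_exists:
  assumes "\<sigma> \<in> policies1 G" "\<delta> \<in> policies2 G"
  shows "\<exists>v\<in>carrier_vec n. f_policies G \<sigma> \<delta> v = v"
proof -
  obtain x where x: "x \<in> carrier_vec n"
    "\<forall>i<n. 1 * x $ i = (trans_mat G \<sigma> \<delta> *\<^sub>v x) $ i + pay_vec G \<sigma> \<delta> $ i"
    using shifted_solvable[OF trans_mat_carrier trans_mat_nonneg[OF assms] radius[OF assms] lam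
        pay_vec_carrier] by blast
  then have "f_policies G \<sigma> \<delta> x = x"
    unfolding vec_eq_index[OF f_policies_carrier x(1)]
    by (simp add: f_policies_def pay_vec_def)
  with x(1) show ?thesis by blast
qed

text \<open>The fixed points of the affine maps are, up to sign, the policy values of the inner
  game, so its value exists. The same argument one level higher, with these values as policy values,
  serves \<open>f_op\<close>.\<close>

lemma f_policy_fixpoint_exists:
  assumes \<sigma>: "\<sigma> \<in> policies1 G"
  shows "\<exists>v\<in>carrier_vec n. f_policy G \<sigma> v = v"
proof -
  interpret inner: contracting_game n "\<lambda>i. set (acts2 G i)" "inner_op \<sigma>" u \<mu>
    by (rule inner_contracting[OF \<sigma>])
  have "\<exists>x. \<forall>i<n. inner.F x i = x i"
  proof (rule inner.value_exists)
    fix p assume "p \<in> (\<Pi>\<^sub>E i\<in>{..<n}. set (acts2 G i))"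
    then obtain \<delta> where \<delta>: "\<delta> \<in> policies2 G" "\<forall>i<n. \<forall>a. \<delta> (i, a) = p i"
      using policy2_exists[of "\<lambda>i a. p i"] by auto
    obtain v where v: "v \<in> carrier_vec n" "f_policies G \<sigma> \<delta> v = v"
      using f_policies_fixpoint_exists[OF \<sigma> \<delta>(1)] by blast
    have "\<forall>i<n. inner_op \<sigma> i (p i) (\<lambda>j. - v $ j) = - v $ i"
      using inner_op_index[OF v(1), of _ \<sigma> \<delta>] v(2) \<delta>(2) by simp
    then show "\<exists>x. \<forall>i<n. inner_op \<sigma> i (p i) x = x i" by (intro exI)
  qed
  then obtain x where x: "\<And>i. i < n \<Longrightarrow> inner.F x i = x i" by blast
  let ?v = "vec n (\<lambda>i. - x i)"
  have "f_policy G \<sigma> ?v $ i = ?v $ i" if "i < n" for i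
  proof -
    have "inner.F (\<lambda>j. - ?v $ j) i = inner.F x i"
      using that by (intro inner.F_cong) auto
    then show ?thesis using inner_F_index[OF \<sigma>, of ?v i] x that by simp
  qed
  then have "f_policy G \<sigma> ?v = ?v" by (subst vec_eq_index) auto
  then show ?thesis by (intro bexI[of _ ?v]) auto
qed

lemma f_op_fixpoint_exists: "\<exists>v\<in>carrier_vec n. f_op G v = v"
proof -
  interpret outer: contracting_game n "\<lambda>i. set (acts1 G i)" outer_op u \<mu>
    by (rule outer_contracting)
  have "\<exists>x. \<forall>i<n. outer.F x i = x i"
  proof (rule outer.value_exists)
    fix \<sigma> assume "\<sigma> \<in> (\<Pi>\<^sub>E i\<in>{..<n}. set (acts1 G i))"
    then obtain v where "v \<in> carrier_vec n" "f_policy G \<sigma> v = v"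
      using f_policy_fixpoint_exists unfolding policies1_def by blast
    then have "\<forall>i<n. outer_op i (\<sigma> i) (($) v) = v $ i" by (simp add: outer_op_index)
    then show "\<exists>x. \<forall>i<n. outer_op i (\<sigma> i) x = x i" by (intro exI)
  qed
  then obtain x where x: "\<And>i. i < n \<Longrightarrow> outer.F x i = x i" by blast
  have "f_op G (vec n x) $ i = vec n x $ i" if "i < n" for i
  proof -
    have "outer.F (($) (vec n x)) i = outer.F x i"
      using that by (intro outer.F_cong) auto
    then show ?thesis using outer_F_index[of "vec n x" i] x that by simp
  qed
  then have "f_op G (vec n x) = vec n x" by (subst vec_eq_index) auto
  then show ?thesis by (intro bexI[of _ "vec n x"]) auto
qed

lemma f_op_fixpoint_unique:
  assumes "v \<in> carrier_vec n" "w \<in> carrier_vec n" "f_op G v = v" "f_op G w = w"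
  shows "v = w"
proof -
  have "v $ i = w $ i" if "i < n" for i
    using contracting_game.value_unique[OF outer_contracting, of "($) v" "($) w" i] assms that
    by (simp add: outer_F_index)
  then show ?thesis using assms vec_eq_index by blast
qed

text \<open>One link is one nonterminal round of the outer iteration. Its source has been evaluated
  and found not optimal, so \<open>K\<close> links give exactly the \<open>K\<close> unfinished
  iterates required by \<open>policy_iteration_bound\<close>.\<close>

definition improves1 :: "(nat \<Rightarrow> 'a) \<Rightarrow> (nat \<Rightarrow> 'a) \<Rightarrow> bool" where
  "improves1 \<sigma> \<sigma>' \<longleftrightarrow> \<sigma> \<in> policies1 G \<and> (\<exists>v\<in>carrier_vec n.
     f_policy G \<sigma> v = v \<and> f_op G v \<noteq> v \<and> f_op G v = f_policy G \<sigma>' v)"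

definition improves2 :: "(nat \<Rightarrow> 'a) \<Rightarrow> (nat \<times> 'a \<Rightarrow> 'b) \<Rightarrow> (nat \<times> 'a \<Rightarrow> 'b) \<Rightarrow> bool" where
  "improves2 \<sigma> \<delta> \<delta>' \<longleftrightarrow> \<delta> \<in> policies2 G \<and> (\<exists>v\<in>carrier_vec n.
     f_policies G \<sigma> \<delta> v = v \<and> f_policy G \<sigma> v \<noteq> v \<and> f_policy G \<sigma> v = f_policies G \<sigma> \<delta>' v)"

lemma sum_card_acts_le:
  "(\<Sum>i<n. card (set (acts1 G i))) \<le> length (triples G)"
  "(\<Sum>i<n. card (set (acts2 G i))) \<le> length (triples G)"
  using sum_mono[of "{..<n}" "\<lambda>i. card (set (acts1 G i))" "\<lambda>i. length (acts1 G i)"]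
    sum_mono[of "{..<n}" "\<lambda>i. card (set (acts2 G i))" "\<lambda>i. length (acts2 G i)"]
    sum_acts_le_triples[OF G] card_length[of "acts1 G _"] card_length[of "acts2 G _"]
  by (meson le_trans)+

lemma improvements1_bound:
  assumes L: "\<mu> ^ L < 1 - \<mu>" and chain: "(improves1 ^^ K) \<sigma> \<sigma>'"
  shows "K \<le> L * length (triples G)"
proof -
  interpret outer: contracting_game n "\<lambda>i. set (acts1 G i)" outer_op u \<mu>
    by (rule outer_contracting)
  obtain p where p: "\<And>s. s < K \<Longrightarrow> improves1 (p s) (p (Suc s))"
    using chain unfolding relpowp_fun_conv by blast
  then have "\<forall>s. \<exists>v. s < K \<longrightarrow> v \<in> carrier_vec n \<and> f_policy G (p s) v = v \<and> f_op G v \<noteq> v \<and>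
      f_op G v = f_policy G (p (Suc s)) v"
    unfolding improves1_def by blast
  then obtain v where v: "\<And>s. s < K \<Longrightarrow> v s \<in> carrier_vec n"
    "\<And>s. s < K \<Longrightarrow> f_policy G (p s) (v s) = v s" "\<And>s. s < K \<Longrightarrow> f_op G (v s) \<noteq> v s"
    "\<And>s. s < K \<Longrightarrow> f_op G (v s) = f_policy G (p (Suc s)) (v s)"
    unfolding choice_iff by blast
  obtain z where z: "z \<in> carrier_vec n" "f_op G z = z" using f_op_fixpoint_exists by blast
  have "K \<le> L * (\<Sum>i<n. card (set (acts1 G i)))"
  proof (rule outer.policy_iteration_bound[where \<pi> = p and v = "\<lambda>s. ($) (v s)" and z = "($) z"])
    fix s i assume s: "s < K" and i: "i < n"
    show "p s i \<in> set (acts1 G i)" using p[OF s] i by (simp add: improves1_def policy1_mem)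
    show "outer_op i (p s i) (($) (v s)) = v s $ i"
      using v s i by (simp add: outer_op_index)
  next
    fix s i assume s: "Suc s < K" and i: "i < n"
    then show "outer_op i (p (Suc s) i) (($) (v s)) = outer.F (($) (v s)) i"
      using v(1,4)[of s] by (simp add: outer_op_index outer_F_index)
  next
    fix s assume s: "s < K"
    then show "\<exists>i<n. outer.F (($) (v s)) i \<noteq> v s $ i"
      using v(1,3)[of s] vec_eq_index[of "f_op G (v s)" "v s"] by (auto simp: outer_F_index)
  qed (use z L in \<open>auto simp: outer_F_index\<close>)
  also have "\<dots> \<le> L * length (triples G)" using sum_card_acts_le by simp
  finally show ?thesis .
qed

lemma improvements2_bound:
  assumes \<sigma>: "\<sigma> \<in> policies1 G" and L: "\<mu> ^ L < 1 - \<mu>" and chain: "(improves2 \<sigma> ^^ K) \<delta> \<delta>'"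
  shows "K \<le> L * length (triples G)"
proof -
  interpret inner: contracting_game n "\<lambda>i. set (acts2 G i)" "inner_op \<sigma>" u \<mu>
    by (rule inner_contracting[OF \<sigma>])
  obtain p where p: "\<And>s. s < K \<Longrightarrow> improves2 \<sigma> (p s) (p (Suc s))"
    using chain unfolding relpowp_fun_conv by blast
  then have "\<forall>s. \<exists>v. s < K \<longrightarrow> v \<in> carrier_vec n \<and> f_policies G \<sigma> (p s) v = v \<and>
      f_policy G \<sigma> v \<noteq> v \<and> f_policy G \<sigma> v = f_policies G \<sigma> (p (Suc s)) v"
    unfolding improves2_def by blast
  then obtain v where v: "\<And>s. s < K \<Longrightarrow> v s \<in> carrier_vec n"
    "\<And>s. s < K \<Longrightarrow> f_policies G \<sigma> (p s) (v s) = v s" "\<And>s. s < K \<Longrightarrow> f_policy G \<sigma> (v s) \<noteq> v s"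
    "\<And>s. s < K \<Longrightarrow> f_policy G \<sigma> (v s) = f_policies G \<sigma> (p (Suc s)) (v s)"
    unfolding choice_iff by blast
  obtain z where z: "z \<in> carrier_vec n" "f_policy G \<sigma> z = z"
    using f_policy_fixpoint_exists[OF \<sigma>] by blast
  have "K \<le> L * (\<Sum>i<n. card (set (acts2 G i)))"
  \<comment> \<open>Against the fixed \<open>\<sigma>\<close> the one-player policy consists of the
    entries \<open>(i, \<sigma> i)\<close>; the values are negated to match
    \<open>inner_op\<close>.\<close>
  proof (rule inner.policy_iteration_bound[where \<pi> = "\<lambda>s i. p s (i, \<sigma> i)"
        and v = "\<lambda>s i. - v s $ i" and z = "\<lambda>i. - z $ i"])
    fix s i assume s: "s < K" and i: "i < n"
    show "p s (i, \<sigma> i) \<in> set (acts2 G i)" using p[OF s] i by (simp add: improves2_def policy2_mem)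
    show "inner_op \<sigma> i (p s (i, \<sigma> i)) (\<lambda>i. - v s $ i) = - v s $ i"
      using v s i by (simp add: inner_op_index)
  next
    fix s i assume s: "Suc s < K" and i: "i < n"
    then show "inner_op \<sigma> i (p (Suc s) (i, \<sigma> i)) (\<lambda>i. - v s $ i) = inner.F (\<lambda>i. - v s $ i) i"
      using v(1,4)[of s] by (simp add: inner_op_index inner_F_index \<sigma>)
  next
    fix s assume s: "s < K"
    then show "\<exists>i<n. inner.F (\<lambda>i. - v s $ i) i \<noteq> - v s $ i"
      using v(1,3)[of s] vec_eq_index[of "f_policy G \<sigma> (v s)" "v s"]
      by (auto simp: inner_F_index \<sigma>)
  qed (use z L in \<open>auto simp: inner_F_index \<sigma>\<close>)
  also have "\<dots> \<le> L * length (triples G)" using sum_card_acts_le by simp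
  finally show ?thesis .
qed

end


section \<open>Runs of policy iteration\<close>

lemma poly_nat_mono: "m \<le> k \<Longrightarrow> poly (p :: nat poly) m \<le> poly p k"
  by (induction p) (auto intro!: add_mono mult_mono)

text \<open>The polynomials of the solver and \<open>L\<close> are parameters so that the bounds can
  be written down explicitly; they are chosen before the game, which makes the bounds
  uniform.\<close>

locale policy_iteration = bounded_game G lam for G :: "('a, 'b) game" and lam :: real +
  fixes S :: solver and ps qs :: "nat poly" and L :: nat
  assumes solver: "\<forall>n\<ge>1. \<forall>A\<in>carrier_mat n n. \<forall>b\<in>carrier_vec n. det A \<noteq> 0 \<longrightarrow>
        (let c = solve S n (mat_entries A) (list_of_vec b);
             input = mat_entries A @ list_of_vec b
         in length (result c) = n \<and> A *\<^sub>v vec_of_list (result c) = b \<and>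
            length (events c) \<le> poly ps n \<and>
            (set input \<subseteq> \<rat> \<longrightarrow>
               (\<forall>x \<in> set (result c) \<union> \<Union> (numbers ` set (events c)).
                  x \<in> \<rat> \<and> bit_size x \<le> poly qs (total_bits input))))"
    and L: "\<mu> ^ L < 1 - \<mu>"
begin

lemma n_pos: "1 \<le> n"
  using G by (simp add: game_instance_def)

lemma det_system_mat:
  assumes "\<sigma> \<in> policies1 G" "\<delta> \<in> policies2 G"
  shows "det (system_mat G \<sigma> \<delta>) \<noteq> 0"
proof -
  have "(1 :: real) \<cdot>\<^sub>m 1\<^sub>m n = 1\<^sub>m n" by auto
  then show ?thesis
    using det_shifted_nonzero[OF trans_mat_carrier trans_mat_nonneg[OF assms] radius[OF assms] lam]
    by (simp add: system_mat_def)
qed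

lemma solver_policies:
  assumes "\<sigma> \<in> policies1 G" "\<delta> \<in> policies2 G"
  defines "c \<equiv> solve_policies S G \<sigma> \<delta>"
    and "input \<equiv> mat_entries (system_mat G \<sigma> \<delta>) @ list_of_vec (pay_vec G \<sigma> \<delta>)"
  shows "length (result c) = n" "system_mat G \<sigma> \<delta> *\<^sub>v vec_of_list (result c) = pay_vec G \<sigma> \<delta>"
    and "cost c \<le> poly ps n"
    and "set input \<subseteq> \<rat> \<Longrightarrow> x \<in> set (result c) \<Longrightarrow> x \<in> \<rat> \<and> bit_size x \<le> poly qs (total_bits input)"
    and "set input \<subseteq> \<rat> \<Longrightarrow> events_satisfy (\<lambda>x. x \<in> \<rat> \<and> bit_size x \<le> poly qs (total_bits input)) c"
  using solver[rule_format, OF n_pos system_mat_carrier pay_vec_carrier[of G \<sigma> \<delta>]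
      det_system_mat[OF assms(1,2)]]
  unfolding Let_def c_def[symmetric] input_def[symmetric] cost_def[symmetric] events_satisfy_def
  by auto

lemma fixpoint_correct:
  assumes "\<sigma> \<in> policies1 G" "\<delta> \<in> policies2 G"
  shows "result (fixpoint_comp S G \<sigma> \<delta>) \<in> carrier_vec n"
    and "f_policies G \<sigma> \<delta> (result (fixpoint_comp S G \<sigma> \<delta>)) = result (fixpoint_comp S G \<sigma> \<delta>)"
proof -
  let ?v = "result (fixpoint_comp S G \<sigma> \<delta>)"
  show v: "?v \<in> carrier_vec n"
    using solver_policies(1)[OF assms] by (intro carrier_vecI) (simp add: result_fixpoint_comp)
  have one: "(1 :: real) \<cdot>\<^sub>m 1\<^sub>m n = 1\<^sub>m n" by auto
  have "f_policies G \<sigma> \<delta> ?v $ i = ?v $ i" if i: "i < n" for i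
  proof -
    have "(system_mat G \<sigma> \<delta> *\<^sub>v ?v) $ i = pay_vec G \<sigma> \<delta> $ i"
      using solver_policies(2)[OF assms] by (simp add: result_fixpoint_comp)
    moreover have "(system_mat G \<sigma> \<delta> *\<^sub>v ?v) $ i = ?v $ i - (trans_mat G \<sigma> \<delta> *\<^sub>v ?v) $ i"
      using shifted_mult_vec_index[OF trans_mat_carrier v i, of 1 \<sigma> \<delta>]
      unfolding one system_mat_def by simp
    moreover have "f_policies G \<sigma> \<delta> ?v $ i = (trans_mat G \<sigma> \<delta> *\<^sub>v ?v) $ i + pay_vec G \<sigma> \<delta> $ i"
      using i by (simp add: f_policies_def pay_vec_def)
    ultimately show ?thesis by linarith
  qed
  then show "f_policies G \<sigma> \<delta> ?v = ?v" using v by (simp add: vec_eq_index)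
qed

section \<open>Counting transitions by improvements\<close>

definition chain_length :: nat where
  "chain_length = L * length (triples G)"

text \<open>The numbers \<open>s\<close> and \<open>t\<close> count the improvements of the first player so far, and those of the
  second player since the last one of the first.\<close>

definition reached :: "nat \<Rightarrow> nat \<Rightarrow> (nat \<Rightarrow> 'a) \<Rightarrow> (nat \<times> 'a \<Rightarrow> 'b) \<Rightarrow> bool" where
  "reached k d \<sigma> \<delta> \<longleftrightarrow> \<sigma> \<in> policies1 G \<and> \<delta> \<in> policies2 G \<and>
     (\<exists>s t \<sigma>\<^sub>0 \<delta>\<^sub>0. (improves1 ^^ s) \<sigma>\<^sub>0 \<sigma> \<and> (improves2 \<sigma> ^^ t) \<delta>\<^sub>0 \<delta> \<and>
        k \<le> s * (4 + 2 * chain_length) + 2 * t + d)"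

text \<open>A round of the outer iteration passes \<open>Outer\<close>, \<open>Inner\<close>,
  \<open>Improve2\<close>, \<open>Improve1\<close> in 4 transitions, plus 2 for each inner
  improvement; the second argument of \<open>reached\<close> is the position in this cycle.
  Recording \<open>v\<close> as the output of the solver keeps its bit size tied to the
  input.\<close>

fun invariant :: "nat \<Rightarrow> ('a, 'b) config \<Rightarrow> bool" where
  "invariant k (Outer \<sigma>) \<longleftrightarrow> \<sigma> \<in> policies1 G \<and>
     (\<exists>s \<sigma>\<^sub>0. (improves1 ^^ s) \<sigma>\<^sub>0 \<sigma> \<and> k \<le> s * (4 + 2 * chain_length))"
| "invariant k (Inner \<sigma> \<delta>) \<longleftrightarrow> reached k 1 \<sigma> \<delta>"
| "invariant k (Improve2 \<sigma> \<delta> v) \<longleftrightarrow> reached k 2 \<sigma> \<delta> \<and> v = result (fixpoint_comp S G \<sigma> \<delta>)"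
| "invariant k (Improve1 \<sigma> \<delta> v) \<longleftrightarrow> reached k 3 \<sigma> \<delta> \<and> v = result (fixpoint_comp S G \<sigma> \<delta>) \<and>
     f_policy G \<sigma> v = f_policies G \<sigma> \<delta> v"
| "invariant k (Done v \<sigma> \<delta>) \<longleftrightarrow> is_solution G v \<sigma> \<delta> \<and>
     k \<le> (chain_length + 1) * (4 + 2 * chain_length)"

lemma reached_Suc: "reached k d \<sigma> \<delta> \<Longrightarrow> reached (Suc k) (Suc d) \<sigma> \<delta>"
  unfolding reached_def by simp

text \<open>At most \<open>chain_length\<close> rounds are complete, and the current one, of at most
  \<open>4 + 2 * chain_length\<close> transitions, accounts for the added 1.\<close>

lemma reached_bound:
  assumes "reached k d \<sigma> \<delta>" "d \<le> 4"
  shows "k \<le> (chain_length + 1) * (4 + 2 * chain_length)"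
proof -
  let ?c = "4 + 2 * chain_length"
  obtain s t \<sigma>\<^sub>0 \<delta>\<^sub>0 where st: "(improves1 ^^ s) \<sigma>\<^sub>0 \<sigma>" "(improves2 \<sigma> ^^ t) \<delta>\<^sub>0 \<delta>"
    and k: "k \<le> s * ?c + 2 * t + d"
    using assms(1) unfolding reached_def by blast
  have "s \<le> chain_length" "t \<le> chain_length"
    using improvements1_bound[OF L st(1)] improvements2_bound[OF _ L st(2)] assms(1)
    by (simp_all add: chain_length_def reached_def)
  then have "s * ?c \<le> chain_length * ?c" "2 * t + d \<le> ?c" using assms(2) by auto
  with k show ?thesis by (simp add: algebra_simps)
qed

lemma invariant_bound:
  assumes "invariant k c"
  shows "k \<le> (chain_length + 1) * (4 + 2 * chain_length)"
proof (cases c)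
  case (Outer \<sigma>)
  then obtain s \<sigma>\<^sub>0 where s: "(improves1 ^^ s) \<sigma>\<^sub>0 \<sigma>" and k: "k \<le> s * (4 + 2 * chain_length)"
    using assms by auto
  have "s \<le> chain_length + 1"
    using improvements1_bound[OF L s] by (simp add: chain_length_def)
  then have "s * (4 + 2 * chain_length) \<le> (chain_length + 1) * (4 + 2 * chain_length)"
    by (rule mult_le_mono1)
  with k show ?thesis by (rule le_trans)
qed (use assms reached_bound in \<open>auto simp del: mult_Suc_right\<close>)

lemma invariant_step:
  assumes inv: "invariant k c" and step: "pi_step S G c l c'"
  shows "invariant (Suc k) c'"
  using step
proof cases
  case (init2 \<delta> \<sigma>)
  then obtain s \<sigma>\<^sub>0 where st: "(improves1 ^^ s) \<sigma>\<^sub>0 \<sigma>" "(improves2 \<sigma> ^^ 0) \<delta> \<delta>"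
    and k: "k \<le> s * (4 + 2 * chain_length)" and \<sigma>: "\<sigma> \<in> policies1 G"
    using inv by auto
  have "Suc k \<le> s * (4 + 2 * chain_length) + 2 * 0 + 1" using k by simp
  then have "reached (Suc k) 1 \<sigma> \<delta>"
    unfolding reached_def using st \<sigma> init2(4) by blast
  then show ?thesis using init2(3) by simp
next
  case (evaluate \<sigma> \<delta>)
  then show ?thesis using inv by (auto simp: reached_def)
next
  case (stop2 \<sigma> v \<delta>)
  then show ?thesis using inv by (auto simp: reached_def)
next
  case (improve2 \<sigma> v \<delta> \<delta>')
  have r: "reached k 2 \<sigma> \<delta>" and v: "v = result (fixpoint_comp S G \<sigma> \<delta>)"
    using inv improve2(1) by auto
  then obtain s t \<sigma>\<^sub>0 \<delta>\<^sub>0 where st: "(improves1 ^^ s) \<sigma>\<^sub>0 \<sigma>" "(improves2 \<sigma> ^^ t) \<delta>\<^sub>0 \<delta>"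
    and k: "k \<le> s * (4 + 2 * chain_length) + 2 * t + 2" and pol: "\<sigma> \<in> policies1 G" "\<delta> \<in> policies2 G"
    unfolding reached_def by blast
  have "improves2 \<sigma> \<delta> \<delta>'"
    unfolding improves2_def using pol fixpoint_correct[OF pol] improve2 v by metis
  with st(2) have "(improves2 \<sigma> ^^ Suc t) \<delta>\<^sub>0 \<delta>'" by (simp add: relcompp.intros)
  moreover have "Suc k \<le> s * (4 + 2 * chain_length) + 2 * Suc t + 1" using k by simp
  ultimately have "reached (Suc k) 1 \<sigma> \<delta>'"
    unfolding reached_def using st(1) pol(1) improve2(5) by blast
  then show ?thesis using improve2(3) by simp
next
  case (stop1 v \<sigma> \<delta>' \<delta>)
  have r: "reached k 3 \<sigma> \<delta>" and v: "v = result (fixpoint_comp S G \<sigma> \<delta>)"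
    and opt: "f_policy G \<sigma> v = f_policies G \<sigma> \<delta> v"
    using inv stop1(1) by auto
  then have pol: "\<sigma> \<in> policies1 G" "\<delta> \<in> policies2 G" by (auto simp: reached_def)
  \<comment> \<open>Both stopping tests together close the chain from \<open>f_op\<close> over
    \<open>f_policy\<close> to the affine map, which fixes \<open>v\<close>.\<close>
  have v': "v \<in> carrier_vec n" "f_op G v = v"
    using fixpoint_correct[OF pol] v opt stop1 by auto
  then have "is_solution G v \<sigma> \<delta>'"
    unfolding is_solution_def using f_op_fixpoint_unique pol stop1 by blast
  moreover have "reached (Suc k) 4 \<sigma> \<delta>" using reached_Suc[OF r] by simp
  ultimately show ?thesis using reached_bound stop1(3) by simp
next
  case (improve1 v \<sigma> \<sigma>' \<delta>)
  have r: "reached k 3 \<sigma> \<delta>" and v: "v = result (fixpoint_comp S G \<sigma> \<delta>)"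
    and opt: "f_policy G \<sigma> v = f_policies G \<sigma> \<delta> v"
    using inv improve1(1) by auto
  then obtain s t \<sigma>\<^sub>0 \<delta>\<^sub>0 where st: "(improves1 ^^ s) \<sigma>\<^sub>0 \<sigma>" "(improves2 \<sigma> ^^ t) \<delta>\<^sub>0 \<delta>"
    and k: "k \<le> s * (4 + 2 * chain_length) + 2 * t + 3" and pol: "\<sigma> \<in> policies1 G" "\<delta> \<in> policies2 G"
    unfolding reached_def by blast
  have "f_policy G \<sigma> v = v" using opt fixpoint_correct[OF pol] v by simp
  then have "improves1 \<sigma> \<sigma>'"
    unfolding improves1_def using pol fixpoint_correct(1)[OF pol] improve1 v by metis
  with st(1) have "(improves1 ^^ Suc s) \<sigma>\<^sub>0 \<sigma>'" by (simp add: relcompp.intros)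
  moreover have "t \<le> chain_length"
    using improvements2_bound[OF pol(1) L st(2)] by (simp add: chain_length_def)
  then have "Suc k \<le> Suc s * (4 + 2 * chain_length)" using k by simp
  ultimately show ?thesis
    unfolding improve1(3) invariant.simps using improve1(5) by blast
qed

section \<open>No run gets stuck before a solution\<close>

lemma best_responses_exist:
  "\<exists>f. \<forall>i<n. \<forall>a. f i a \<in> set (acts2 G i) \<and>
     payoff G v i a (f i a) = Max ((\<lambda>b. payoff G v i a b) ` set (acts2 G i))"
proof -
  have "\<exists>b. i < n \<longrightarrow> b \<in> set (acts2 G i) \<and>
     payoff G v i a b = Max ((\<lambda>b. payoff G v i a b) ` set (acts2 G i))" for i a
  proof (cases "i < n")
    case True
    then have "Max ((\<lambda>b. payoff G v i a b) ` set (acts2 G i)) \<in> (\<lambda>b. payoff G v i a b) ` set (acts2 G i)"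
      using acts_nonempty by (intro Max_in) auto
    then show ?thesis by (metis imageE)
  qed simp
  then show ?thesis by metis
qed

lemma progress:
  assumes inv: "invariant k c"
  shows "(\<exists>l' c'. pi_step S G c l' c') \<or> (\<exists>v \<sigma> \<delta>. c = Done v \<sigma> \<delta> \<and> is_solution G v \<sigma> \<delta>)"
proof (cases c)
  case (Outer \<sigma>)
  obtain \<delta> where "\<delta> \<in> policies2 G"
    using policy2_exists[of "\<lambda>i a. hd (acts2 G i)"] acts_nonempty by auto
  then show ?thesis unfolding Outer by (blast intro: pi_step.init2)
next
  case (Inner \<sigma> \<delta>)
  then show ?thesis by (blast intro: pi_step.evaluate)
next
  case (Improve2 \<sigma> \<delta> v)
  then have v: "v \<in> carrier_vec n"
    using inv fixpoint_correct(1) by (auto simp: reached_def)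
  obtain f where f: "\<And>i a. i < n \<Longrightarrow> f i a \<in> set (acts2 G i) \<and>
     payoff G v i a (f i a) = Max ((\<lambda>b. payoff G v i a b) ` set (acts2 G i))"
    using best_responses_exist by blast
  obtain \<delta>' where "\<delta>' \<in> policies2 G" "\<forall>i<n. \<forall>a. \<delta>' (i, a) = f i a"
    using policy2_exists[of f] f by blast
  moreover from this have "f_policy G \<sigma> v = f_policies G \<sigma> \<delta>' v"
    using f by (simp add: maximizing_policies[OF G v] f_policy_index[OF G v])
  ultimately show ?thesis
    unfolding Improve2 by (cases "f_policy G \<sigma> v = f_policies G \<sigma> \<delta> v")
      (blast intro: pi_step.stop2 pi_step.improve2)+
next
  case (Improve1 \<sigma> \<delta> v)
  then have pol: "\<sigma> \<in> policies1 G" "\<delta> \<in> policies2 G" and v: "v \<in> carrier_vec n"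
    and opt: "f_policy G \<sigma> v = f_policies G \<sigma> \<delta> v"
    using inv fixpoint_correct(1) by (auto simp: reached_def)
  show ?thesis
  proof (cases "f_op G v = f_policy G \<sigma> v")
    case True
    obtain f where f: "\<And>i a. i < n \<Longrightarrow> f i a \<in> set (acts2 G i) \<and>
       payoff G v i a (f i a) = Max ((\<lambda>b. payoff G v i a b) ` set (acts2 G i))"
      using best_responses_exist by blast
    \<comment> \<open>Rule \<open>stop1\<close> demands agreement with \<open>\<delta>\<close> along
      \<open>\<sigma>\<close>, where \<open>opt\<close> already makes \<open>\<delta>\<close> a best
      response; at all other actions any maximizer will do.\<close>
    have "\<exists>\<delta>'\<in>policies2 G. \<forall>i<n. \<forall>a. \<delta>' (i, a) = (if a = \<sigma> i then \<delta> (i, \<sigma> i) else f i a)"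
      using f policy2_mem[OF pol(2)] by (intro policy2_exists) simp
    then obtain \<delta>' where \<delta>': "\<delta>' \<in> policies2 G"
      "\<And>i a. i < n \<Longrightarrow> \<delta>' (i, a) = (if a = \<sigma> i then \<delta> (i, \<sigma> i) else f i a)"
      by blast
    have "payoff G v i (\<sigma> i) (\<delta> (i, \<sigma> i)) = Max (payoff G v i (\<sigma> i) ` set (acts2 G i))" if "i < n" for i
      using opt that by (simp add: maximizing_policies[OF G v] f_policy_index[OF G v])
    then have "f_policy G \<tau> v = f_policies G \<tau> \<delta>' v" for \<tau>
      using f \<delta>'(2) by (simp add: maximizing_policies[OF G v] f_policy_index[OF G v])
    then have "pi_step S G c (events (eval_comp G v)) (Done v \<sigma> \<delta>')"
      unfolding Improve1 using True \<delta>' by (intro pi_step.stop1) auto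
    then show ?thesis by blast
  next
    case False
    let ?m = "\<lambda>i a. Max (payoff G v i a ` set (acts2 G i))"
    have "\<exists>a. i < n \<longrightarrow> a \<in> set (acts1 G i) \<and> ?m i a = f_op G v $ i" for i
    proof (cases "i < n")
      case True
      then have "\<exists>a\<in>set (acts1 G i). ?m i a = Min (?m i ` set (acts1 G i))"
        using acts_nonempty by (intro Min_image_attained) auto
      then show ?thesis using True by (auto simp: f_op_def)
    qed simp
    then obtain h where h: "\<And>i. i < n \<Longrightarrow> h i \<in> set (acts1 G i) \<and> ?m i (h i) = f_op G v $ i"
      by metis
    then obtain \<sigma>' where \<sigma>': "\<sigma>' \<in> policies1 G" "\<forall>i<n. \<sigma>' i = h i"
      using policy1_exists[of h] by blast
    then have "f_op G v = f_policy G \<sigma>' v"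
      using h by (simp add: minimizing_policies[OF G v])
    with \<sigma>'(1) False have "pi_step S G c (events (eval_comp G v)) (Outer \<sigma>')"
      unfolding Improve1 by (intro pi_step.improve1)
    then show ?thesis by blast
  qed
next
  case (Done v \<sigma> \<delta>)
  then show ?thesis using inv by simp
qed

section \<open>Arithmetic cost and bit size of a single transition\<close>

definition step_cost :: "nat \<Rightarrow> nat" where
  "step_cost N = 2 * N ^ 2 + poly ps N + N * (3 * N ^ 2 + 2 * N) +
     N * (N * (3 * N ^ 2 + 2 * N) + 2 * N)"

lemma length_events_step:
  assumes inv: "invariant k c" and step: "pi_step S G c l c'"
  shows "length l \<le> step_cost (n + length (triples G))"
proof -
  let ?N = "n + length (triples G)"
  have eval: "length (events (eval_comp G v)) \<le> step_cost ?N"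
    and eval2: "length (events (eval_policy_comp G \<sigma> v)) \<le> step_cost ?N" for v \<sigma>
    using cost_eval_comp_le[OF G refl, of v] cost_eval_policy_comp_le[OF G refl, of \<sigma> v]
    unfolding cost_def step_cost_def by linarith+
  have fixpoint: "length (events (fixpoint_comp S G \<sigma> \<delta>)) \<le> step_cost ?N"
    if "\<sigma> \<in> policies1 G" "\<delta> \<in> policies2 G" for \<sigma> \<delta>
  proof -
    have "n ^ 2 \<le> ?N ^ 2" by (intro power_mono) auto
    moreover have "poly ps n \<le> poly ps ?N" by (intro poly_nat_mono) simp
    ultimately show ?thesis
      using cost_fixpoint_comp_le[of S G \<sigma> \<delta>] solver_policies(3)[OF that]
      unfolding cost_def step_cost_def by linarith
  qed
  from step show ?thesis
  proof cases
    case (evaluate \<sigma> \<delta>)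
    then show ?thesis using fixpoint inv by (simp add: reached_def)
  qed (simp_all add: eval eval2)
qed

text \<open>With \<open>n \<le> T\<close>, the system has at most \<open>T ^ 2 + T\<close> entries.
  An entry of \<open>1 - M\<close> is a \<open>bounded_rat\<close> of level
  \<open>2 * T + 1\<close>, hence has at most \<open>2 * (2 * T + 1) + 3 = 4 * T + 5\<close>
  bits.\<close>

definition solution_bits :: "nat \<Rightarrow> nat" where
  "solution_bits T = poly qs ((T ^ 2 + T) * (4 * T + 5))"

definition payoff_bits :: "nat \<Rightarrow> nat" where
  "payoff_bits T = T + T * (2 * T + solution_bits T + 1)"

text \<open>The three summands bound, in this order, the numbers in payoff evaluations, those inside
  the solver, and those met while setting up its system. A sum replaces their maximum to remain a
  polynomial.\<close>

definition step_bits :: "nat \<Rightarrow> nat" where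
  "step_bits T = (2 * payoff_bits T + 3) + solution_bits T + (4 * T + 5)"

context
  assumes rational: "set (game_data G) \<subseteq> \<rat>"
begin

abbreviation T :: nat where "T \<equiv> total_bits (game_data G)"

abbreviation short :: "real \<Rightarrow> bool" where
  "short x \<equiv> x \<in> \<rat> \<and> bit_size x \<le> step_bits T"

lemma bounded_rat_game_data: "x \<in> set (game_data G) \<Longrightarrow> bounded_rat T x"
  using bounded_rat_mono[OF bounded_rat_bit_size bit_size_le_total_bits] rational by blast

lemma bounded_rat_system:
  assumes "\<sigma> \<in> policies1 G" "\<delta> \<in> policies2 G" "i < n" "j < n"
  defines "a \<equiv> \<sigma> i" and "b \<equiv> \<delta> (i, \<sigma> i)"
  shows "bounded_rat T (disc G i a b)" "bounded_rat T (prob G i a b j)" "bounded_rat T (pay G i a b)"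
    "bounded_rat (2 * T) (disc G i a b * prob G i a b j)"
    "bounded_rat (2 * T + 1) (system_mat G \<sigma> \<delta> $$ (i, j))"
proof -
  note mem = game_data_mem[OF assms(3) policy1_mem[OF assms(1,3)] policy2_mem[OF assms(2,3), of "\<sigma> i"],
      folded a_def b_def]
  show 1: "bounded_rat T (disc G i a b)" "bounded_rat T (prob G i a b j)" "bounded_rat T (pay G i a b)"
    using mem assms(4) by (auto intro: bounded_rat_game_data)
  show 2: "bounded_rat (2 * T) (disc G i a b * prob G i a b j)"
    using bounded_rat_mult[OF 1(1,2)] by (simp add: mult_2)
  have "bounded_rat 0 (if i = j then 1 else 0)"
    using bounded_rat_0 bounded_rat_1 by simp
  from bounded_rat_diff[OF this 2] show "bounded_rat (2 * T + 1) (system_mat G \<sigma> \<delta> $$ (i, j))"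
    using assms(3,4) by (simp add: system_mat_def trans_mat_def a_def b_def)
qed

lemma solver_input_bits:
  assumes "\<sigma> \<in> policies1 G" "\<delta> \<in> policies2 G"
  defines "input \<equiv> mat_entries (system_mat G \<sigma> \<delta>) @ list_of_vec (pay_vec G \<sigma> \<delta>)"
  shows "set input \<subseteq> \<rat>" "poly qs (total_bits input) \<le> solution_bits T"
proof -
  have entry: "x \<in> \<rat> \<and> bit_size x \<le> 4 * T + 5" if "x \<in> set input" for x
  proof -
    consider i j where "i < n" "j < n" "x = system_mat G \<sigma> \<delta> $$ (i, j)"
      | i where "i < n" "x = pay G i (\<sigma> i) (\<delta> (i, \<sigma> i))"
      using \<open>x \<in> set input\<close>
      by (auto simp: input_def mat_entries_eq[OF system_mat_carrier] list_of_vec_pay_vec)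
    then have "bounded_rat (2 * T + 1) x"
    proof cases
      case 1
      then show ?thesis using bounded_rat_system(5)[OF assms(1,2)] by simp
    next
      case 2
      then have "bounded_rat T x" using bounded_rat_system(3)[OF assms(1,2)] by simp
      then show ?thesis by (rule bounded_rat_mono) simp
    qed
    from bit_size_bounded_rat[OF this] show ?thesis by simp
  qed
  then show "set input \<subseteq> \<rat>" by blast
  have "length input = n * n + n"
    by (simp add: input_def mat_entries_eq[OF system_mat_carrier] list_of_vec_pay_vec length_concat
        comp_def sum_list_triv)
  also have "\<dots> \<le> T ^ 2 + T"
    using nstates_le_total_bits[OF G] by (auto simp: power2_eq_square intro!: add_mono mult_mono)
  finally have "length input * (4 * T + 5) \<le> (T ^ 2 + T) * (4 * T + 5)"
    by (rule mult_le_mono1)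
  with total_bits_le[of input "4 * T + 5"] entry
  have "total_bits input \<le> (T ^ 2 + T) * (4 * T + 5)" by (meson le_trans)
  then show "poly qs (total_bits input) \<le> solution_bits T"
    unfolding solution_bits_def by (rule poly_nat_mono)
qed

lemma solution_bounded_rat:
  assumes "\<sigma> \<in> policies1 G" "\<delta> \<in> policies2 G" "j < n"
  shows "bounded_rat (solution_bits T) (result (fixpoint_comp S G \<sigma> \<delta>) $ j)"
proof -
  let ?xs = "result (solve_policies S G \<sigma> \<delta>)"
  have mem: "?xs ! j \<in> set ?xs" using solver_policies(1)[OF assms(1,2)] assms(3) by simp
  then have x: "?xs ! j \<in> \<rat>" "bit_size (?xs ! j) \<le> solution_bits T"
    using solver_policies(4)[OF assms(1,2) solver_input_bits(1)[OF assms(1,2)] mem]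
      solver_input_bits(2)[OF assms(1,2)] by auto
  have "result (fixpoint_comp S G \<sigma> \<delta>) $ j = ?xs ! j"
    by (simp add: result_fixpoint_comp vec_of_list_index)
  then show ?thesis
    using bounded_rat_mono[OF bounded_rat_bit_size[OF x(1)] x(2)] by simp
qed

lemma short_if_bounded_rat: "bounded_rat a x \<Longrightarrow> 2 * a + 3 \<le> step_bits T \<Longrightarrow> short x"
  using bit_size_bounded_rat[of a x] by simp

lemma fixpoint_comp_short:
  assumes "\<sigma> \<in> policies1 G" "\<delta> \<in> policies2 G"
  shows "events_satisfy short (fixpoint_comp S G \<sigma> \<delta>)"
proof (rule events_satisfy_fixpoint_comp)
  have le: "2 * T + 3 \<le> step_bits T" "2 * (2 * T) + 3 \<le> step_bits T" "2 * (2 * T + 1) + 3 \<le> step_bits T"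
    by (simp_all add: step_bits_def)
  fix i j assume ij: "i < n" "j < n"
  note b = bounded_rat_system[OF assms ij]
  show "short (disc G i (\<sigma> i) (\<delta> (i, \<sigma> i))) \<and> short (prob G i (\<sigma> i) (\<delta> (i, \<sigma> i)) j) \<and>
      short (disc G i (\<sigma> i) (\<delta> (i, \<sigma> i)) * prob G i (\<sigma> i) (\<delta> (i, \<sigma> i)) j) \<and>
      short (system_mat G \<sigma> \<delta> $$ (i, j))"
    by (intro conjI[of "short _"] short_if_bounded_rat[OF b(1) le(1)] short_if_bounded_rat[OF b(2) le(1)]
        short_if_bounded_rat[OF b(4) le(2)] short_if_bounded_rat[OF b(5) le(3)])
next
  show "short 0" "short 1"
    by (rule short_if_bounded_rat[OF bounded_rat_0] short_if_bounded_rat[OF bounded_rat_1],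
        simp add: step_bits_def)+
  show "events_satisfy short (solve_policies S G \<sigma> \<delta>)"
    using solver_policies(5)[OF assms solver_input_bits(1)[OF assms]]
    by (rule events_satisfy_mono)
      (use solver_input_bits(2)[OF assms] in \<open>auto simp: step_bits_def\<close>)
qed

lemma payoff_comp_short:
  assumes "\<sigma> \<in> policies1 G" "\<delta> \<in> policies2 G" "v = result (fixpoint_comp S G \<sigma> \<delta>)"
    and iab: "i < n" "a \<in> set (acts1 G i)" "b \<in> set (acts2 G i)"
  shows "events_satisfy short (payoff_comp G v i a b) \<and> short (payoff G v i a b)"
proof -
  have "n * (2 * T + solution_bits T + 1) \<le> T * (2 * T + solution_bits T + 1)"
    using nstates_le_total_bits[OF G] by (rule mult_le_mono1)
  then have "events_satisfy (bounded_rat (payoff_bits T)) (payoff_comp G v i a b) \<and>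
      bounded_rat (payoff_bits T) (payoff G v i a b)"
    using solution_bounded_rat[OF assms(1,2)] assms(3) game_data_mem[OF iab]
    by (intro bounded_rat_payoff_comp[of T _ _ _ _ "solution_bits T"])
      (auto simp: payoff_bits_def intro: bounded_rat_game_data)
  moreover have "short x" if "bounded_rat (payoff_bits T) x" for x
    using that by (rule short_if_bounded_rat) (simp add: step_bits_def)
  ultimately show ?thesis by (blast intro: events_satisfy_mono)
qed

lemma numbers_step:
  assumes inv: "invariant k c" and step: "pi_step S G c l c'"
  shows "\<forall>e\<in>set l. \<forall>x\<in>numbers e. short x"
proof -
  have eval: "events_satisfy short (eval_comp G v)"
    and eval2: "events_satisfy short (eval_policy_comp G \<sigma> v)"
    if "\<sigma> \<in> policies1 G" "\<delta> \<in> policies2 G" "v = result (fixpoint_comp S G \<sigma> \<delta>)" for \<sigma> \<delta> v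
    using events_satisfy_eval_comp[OF G payoff_comp_short[OF that]]
      events_satisfy_eval_policy_comp[OF G that(1) payoff_comp_short[OF that]] by blast+
  from step show ?thesis
  proof cases
    case (evaluate \<sigma> \<delta>)
    then have "\<sigma> \<in> policies1 G" "\<delta> \<in> policies2 G" using inv by (simp_all add: reached_def)
    from fixpoint_comp_short[OF this] show ?thesis
      unfolding evaluate(2) events_satisfy_def .
  qed (use inv eval eval2 in \<open>auto simp: reached_def events_satisfy_def\<close>)
qed

end

lemma run_invariant:
  assumes "pi_run S G k l c"
  shows "invariant k c \<and> length l \<le> k * step_cost (n + length (triples G)) \<and>
    (set (game_data G) \<subseteq> \<rat> \<longrightarrow> (\<forall>x\<in>\<Union> (numbers ` set l).
       x \<in> \<rat> \<and> bit_size x \<le> step_bits (total_bits (game_data G))))"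
  using assms
proof induction
  case (start \<sigma>)
  have "(improves1 ^^ 0) \<sigma> \<sigma>" by simp
  with start show ?case by (auto intro!: exI[of _ 0])
next
  case (step k l c l' c')
  then show ?case
    using invariant_step[OF _ step.hyps(2)] length_events_step[OF _ step.hyps(2)]
      numbers_step[OF _ _ step.hyps(2)] by fastforce
qed

lemma run_bounds:
  assumes "pi_run S G k l c"
  defines "N \<equiv> n + length (triples G)"
  shows "k + length l \<le> (L * N + 1) * (4 + 2 * (L * N)) * (1 + step_cost N)"
proof -
  have "chain_length \<le> L * N" by (simp add: chain_length_def N_def)
  then have "(chain_length + 1) * (4 + 2 * chain_length) \<le> (L * N + 1) * (4 + 2 * (L * N))"
    by (intro mult_mono) auto
  with invariant_bound run_invariant[OF assms(1)]
  have "k \<le> (L * N + 1) * (4 + 2 * (L * N))" by (meson le_trans)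
  then have "k * (1 + step_cost N) \<le> (L * N + 1) * (4 + 2 * (L * N)) * (1 + step_cost N)"
    by (rule mult_le_mono1)
  moreover have "length l \<le> k * step_cost N" using run_invariant[OF assms(1)] by (simp add: N_def)
  ultimately show ?thesis by (simp add: distrib_left)
qed

end

theorem corollary11:
  fixes lam :: real and S :: solver
  assumes "0 \<le> lam" and "lam < 1"
    and "strongly_polynomial_solver S"
  shows "solves_in_strongly_polynomial_time S
    {G :: ('a, 'b) game. game_instance G \<and>
       (\<forall>\<sigma>\<in>policies1 G. \<forall>\<delta>\<in>policies2 G.
          spectral_radius (map_mat complex_of_real (trans_mat G \<sigma> \<delta>)) \<le> lam)}"
proof -
  obtain ps qs :: "nat poly" where solver: "\<forall>n\<ge>1. \<forall>A\<in>carrier_mat n n. \<forall>b\<in>carrier_vec n. det A \<noteq> 0 \<longrightarrow>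
        (let c = solve S n (mat_entries A) (list_of_vec b);
             input = mat_entries A @ list_of_vec b
         in length (result c) = n \<and> A *\<^sub>v vec_of_list (result c) = b \<and>
            length (events c) \<le> poly ps n \<and>
            (set input \<subseteq> \<rat> \<longrightarrow>
               (\<forall>x \<in> set (result c) \<union> \<Union> (numbers ` set (events c)).
                  x \<in> \<rat> \<and> bit_size x \<le> poly qs (total_bits input))))"
    using assms(3) unfolding strongly_polynomial_solver_def by blast
  \<comment> \<open>\<open>L\<close> comes from \<open>lam\<close> alone, before any game is fixed,
    so it may enter \<open>p\<close> as a constant.\<close>
  obtain L where L: "((1 + lam) / 2) ^ L < 1 - (1 + lam) / 2"
    using real_arch_pow_inv[of "1 - (1 + lam) / 2" "(1 + lam) / 2"] assms(2) by auto
  define X :: "nat poly" where "X = [:0, 1:]"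
  have X: "poly X x = x" "poly [:L:] x = L" for x by (simp_all add: X_def)
  note poly_simps = poly_add poly_mult poly_power poly_numeral poly_1 poly_pcompose X
  \<comment> \<open>The polynomials replay \<open>step_cost\<close>, \<open>run_bounds\<close>,
    \<open>solution_bits\<close> and \<open>step_bits\<close> with the indeterminate
    \<open>X\<close> as argument; \<open>qs\<close> is composed because it is applied to the size of
    the linear system and not to that of the game.\<close>
  define E where "E = 2 * X ^ 2 + ps + X * (3 * X ^ 2 + 2 * X) + X * (X * (3 * X ^ 2 + 2 * X) + 2 * X)"
  define p where "p = ([:L:] * X + 1) * (4 + 2 * ([:L:] * X)) * (1 + E)"
  define V where "V = pcompose qs ((X ^ 2 + X) * (4 * X + 5))"
  define q where "q = 2 * (X + X * (2 * X + V + 1)) + 3 + V + (4 * X + 5)"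
  show ?thesis
    unfolding solves_in_strongly_polynomial_time_def
  proof (rule exI[of _ p], rule exI[of _ q], intro ballI allI impI)
    fix G :: "('a, 'b) game" and k l c
    assume "G \<in> {G. game_instance G \<and> (\<forall>\<sigma>\<in>policies1 G. \<forall>\<delta>\<in>policies2 G.
          spectral_radius (map_mat complex_of_real (trans_mat G \<sigma> \<delta>)) \<le> lam)}"
      and run: "pi_run S G k l c"
    then interpret bounded_game G lam
      using assms by unfold_locales auto
    interpret policy_iteration G lam S ps qs L
      using solver L by unfold_locales (simp_all add: \<mu>_def)
    let ?N = "n + length (triples G)" and ?T = "total_bits (game_data G)"
    have "poly p ?N = (L * ?N + 1) * (4 + 2 * (L * ?N)) * (1 + step_cost ?N)"
      unfolding p_def E_def step_cost_def poly_simps ..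
    then have "k + length l \<le> poly p ?N" using run_bounds[OF run] by simp
    moreover have "poly q ?T = step_bits ?T"
      unfolding q_def V_def step_bits_def payoff_bits_def solution_bits_def poly_simps ..
    ultimately show "k + length l \<le> poly p ?N \<and>
        (set (game_data G) \<subseteq> \<rat> \<longrightarrow>
           (\<forall>x \<in> \<Union> (numbers ` set l). x \<in> \<rat> \<and> bit_size x \<le> poly q ?T)) \<and>
        ((\<exists>l' c'. pi_step S G c l' c') \<or> (\<exists>v \<sigma> \<delta>. c = Done v \<sigma> \<delta> \<and> is_solution G v \<sigma> \<delta>))"
      using run_invariant[OF run] progress by metis
  qed
qed

end
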